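(* Let $k$ be a field of characteristic zero and $R=k[x,y,z]$. Every monomial Artinian level algebra $R/I$ of type $2$ has the Weak Lefschetz Property.
   Context: $I\subset R$ is a monomial ideal with $R/I$ Artinian. A standard graded Artinian algebra is level of type $t$ if its socle (annihilator of the homogeneous maximal ideal) has dimension $t$ and is concentrated in one degree. $A=R/I$ has the Weak Lefschetz Property (WLP) if there is a linear form $L\in A_1$ such that for all integers $j$ the multiplication map $\times L:A_j\to A_{j+1}$ has maximal rank (is injective or surjective). *)

theory Defs
  imports
    "HOL-Library.Poly_Mapping"
    "HOL-Algebra.QuotRing"
    "HOL-Algebra.Embedded_Algebras"
    "HOL-Algebra.Algebraic_Closure_Type"
begin

text \<open>
  Polynomials over \<open>'k\<close> in variables indexed by \<open>'v\<close> are finitely supported maps from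
  exponent vectors \<open>'v \<Rightarrow>\<^sub>0 nat\<close> to coefficients; multiplication on \<^type>\<open>poly_mapping\<close> is
  convolution, so this is the usual polynomial ring.
\<close>

type_synonym ('v, 'k) mvpoly = "('v \<Rightarrow>\<^sub>0 nat) \<Rightarrow>\<^sub>0 'k"

datatype xyz = Var_x | Var_y | Var_z

definition PolyR :: "('v, 'k::comm_ring_1) mvpoly ring" where
  "PolyR = ring_of_type_algebra"

definition monom :: "('v \<Rightarrow>\<^sub>0 nat) \<Rightarrow> ('v, 'k::comm_ring_1) mvpoly" where
  "monom m = Poly_Mapping.single m 1"

definition var :: "'v \<Rightarrow> ('v, 'k::comm_ring_1) mvpoly" where
  "var v = monom (Poly_Mapping.single v 1)"

definition const :: "'k::comm_ring_1 \<Rightarrow> ('v, 'k) mvpoly" where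
  "const c = Poly_Mapping.single 0 c"

definition mdeg :: "('v \<Rightarrow>\<^sub>0 nat) \<Rightarrow> nat" where
  "mdeg m = (\<Sum>v\<in>Poly_Mapping.keys m. Poly_Mapping.lookup m v)"

definition monomial_ideal :: "('v, 'k::comm_ring_1) mvpoly set \<Rightarrow> bool" where
  "monomial_ideal I \<longleftrightarrow> (\<exists>M. I = Idl\<^bsub>PolyR\<^esub> (monom ` M))"

text \<open>The degree is an integer; for negative \<open>j\<close> the component is \<open>{0}\<close>.\<close>

definition hom_part :: "int \<Rightarrow> ('v, 'k::comm_ring_1) mvpoly set" where
  "hom_part j = {p. \<forall>m\<in>Poly_Mapping.keys p. int (mdeg m) = j}"

abbreviation quot :: "('v, 'k::comm_ring_1) mvpoly set \<Rightarrow> ('v, 'k) mvpoly set ring" where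
  "quot I \<equiv> PolyR Quot I"

definition cls :: "('v, 'k::comm_ring_1) mvpoly set \<Rightarrow> ('v, 'k) mvpoly \<Rightarrow> ('v, 'k) mvpoly set" where
  "cls I p = I +>\<^bsub>PolyR\<^esub> p"

definition quot_part :: "('v, 'k::comm_ring_1) mvpoly set \<Rightarrow> int \<Rightarrow> ('v, 'k) mvpoly set set" where
  "quot_part I j = cls I ` hom_part j"

definition artinian_ring :: "('a, 'b) ring_scheme \<Rightarrow> bool" where
  "artinian_ring A \<longleftrightarrow> ring A \<and>
     (\<forall>J :: nat \<Rightarrow> 'a set.
        (\<forall>n. ideal (J n) A) \<and> (\<forall>n. J (Suc n) \<subseteq> J n) \<longrightarrow> (\<exists>N. \<forall>n\<ge>N. J n = J N))"

definition hom_max_ideal :: "('v, 'k::comm_ring_1) mvpoly set \<Rightarrow> ('v, 'k) mvpoly set set" where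
  "hom_max_ideal I = Idl\<^bsub>quot I\<^esub> (cls I ` range var)"

definition socle :: "('v, 'k::comm_ring_1) mvpoly set \<Rightarrow> ('v, 'k) mvpoly set set" where
  "socle I = {a \<in> carrier (quot I). \<forall>b\<in>hom_max_ideal I. b \<otimes>\<^bsub>quot I\<^esub> a = \<zero>\<^bsub>quot I\<^esub>}"

text \<open>The dimension is over the copy of \<open>'k\<close> in the quotient formed by the classes of constants.\<close>

definition level_of_type :: "nat \<Rightarrow> ('v, 'k::field) mvpoly set \<Rightarrow> bool" where
  "level_of_type t I \<longleftrightarrow>
     ring.dimension (quot I) t (cls I ` range const) (socle I) \<and>
     (\<exists>d. socle I \<subseteq> quot_part I d)"

definition weak_lefschetz :: "('v, 'k::field) mvpoly set \<Rightarrow> bool" where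
  "weak_lefschetz I \<longleftrightarrow>
     (\<exists>L\<in>quot_part I 1. \<forall>j::int.
        inj_on (\<lambda>a. L \<otimes>\<^bsub>quot I\<^esub> a) (quot_part I j) \<or>
        (\<lambda>a. L \<otimes>\<^bsub>quot I\<^esub> a) ` quot_part I j = quot_part I (j + 1))"

end

theory Submission
  imports Defs "Jordan_Normal_Form.Determinant"
begin

text \<open>
  The socle of \<open>R/I\<close> consists of at most two monomials \<open>m\<^sub>1, m\<^sub>2\<close> of equal degree, so the monomials outside
  \<open>I\<close> are those dividing \<open>m\<^sub>1\<close> or \<open>m\<^sub>2\<close>. After permuting the variables and exchanging \<open>m\<^sub>1, m\<^sub>2\<close> their
  exponents satisfy \<open>a\<^sub>1 \<ge> a\<^sub>2\<close>, \<open>b\<^sub>1 \<ge> b\<^sub>2\<close>, \<open>c\<^sub>1 \<le> c\<^sub>2\<close>. For \<open>L = x + y + z\<close> one eliminates the powers of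
  \<open>z\<close> layer by layer; the kernel and the cokernel of multiplication by \<open>L\<close> in degree \<open>D\<close> then become
  the left and right kernel of a matrix that counts lattice paths in the \<open>(x,y)\<close>-plane with unit steps \<open>x\<close>
  or \<open>y\<close>. The paths first stay in the box \<open>(a\<^sub>2,b\<^sub>2)\<close> and then in the box \<open>(a\<^sub>1,b\<^sub>1)\<close>; monomials of the
  larger box outside the smaller one are additional sources at the moment of change. By the
  Lindstroem--Gessel--Viennot argument every minor counts families of disjoint paths, hence is nonzero in
  characteristic zero as soon as one such family exists. Aligning the sources beyond the right edge of the
  small box with the right end of the targets, and all other sources with the left end, gives an explicit
  family that uses all sources or all targets.
\<close>

section \<open>Determinants of path counts\<close>

text \<open>The first argument of \<open>stay\<close>, \<open>move\<close> and the recursion variable count the steps that remain.\<close>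

fun path_count :: "(nat \<Rightarrow> int \<Rightarrow> bool) \<Rightarrow> (nat \<Rightarrow> int \<Rightarrow> bool) \<Rightarrow> nat \<Rightarrow> int \<Rightarrow> int \<Rightarrow> 'k::comm_ring_1" where
  "path_count stay move 0 p t = (if p = t then 1 else 0)"
| "path_count stay move (Suc r) p t =
     (if stay (Suc r) p then path_count stay move r p t else 0) +
     (if move (Suc r) p then path_count stay move r (p + 1) t else 0)"

definition increasing :: "nat \<Rightarrow> (nat \<Rightarrow> int) \<Rightarrow> bool" where
  "increasing d p \<longleftrightarrow> (\<forall>i j. i < j \<and> j < d \<longrightarrow> p i < p j)"

definition allowed_step ::
    "(nat \<Rightarrow> int \<Rightarrow> bool) \<Rightarrow> (nat \<Rightarrow> int \<Rightarrow> bool) \<Rightarrow> nat \<Rightarrow> int \<Rightarrow> int \<Rightarrow> bool" where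
  "allowed_step stay move r p p' \<longleftrightarrow> (p' = p \<and> stay r p) \<or> (p' = p + 1 \<and> move r p)"

text \<open>All paths advance simultaneously, so they are disjoint when their positions differ at
  every time. As a step is 0 or 1, distinct positions keep their order, and disjointness becomes
  strict monotonicity in the index.\<close>

fun disjoint_paths ::
    "(nat \<Rightarrow> int \<Rightarrow> bool) \<Rightarrow> (nat \<Rightarrow> int \<Rightarrow> bool) \<Rightarrow> nat \<Rightarrow> (nat \<Rightarrow> int) \<Rightarrow> nat \<Rightarrow> (nat \<Rightarrow> int) \<Rightarrow> bool" where
  "disjoint_paths stay move d t 0 p \<longleftrightarrow> (\<forall>i<d. p i = t i)"
| "disjoint_paths stay move d t (Suc r) p \<longleftrightarrow>
     (\<exists>p'. increasing d p' \<and> (\<forall>i<d. allowed_step stay move (Suc r) (p i) (p' i)) \<and>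
           disjoint_paths stay move d t r p')"

text \<open>By strong induction neither sequence can take its value at \<open>i\<close> at an
  earlier index of the other, where both already agree; so each of the two values bounds the
  other.\<close>

lemma increasing_image_eq:
  assumes "increasing d p" "increasing d t" "p ` {..<d} = t ` {..<d}" "i < d"
  shows "p i = t i"
  using \<open>i < d\<close>
proof (induction i rule: less_induct)
  case (less i)
  obtain j where j: "j < d" "p i = t j" using assms(3) less.prems by blast
  obtain l where l: "l < d" "t i = p l" using assms(3) less.prems by blast
  have "\<not> j < i"
  proof
    assume "j < i"
    then have "p j = t j" using less by auto
    then show False using assms(1) \<open>j < i\<close> less.prems j unfolding increasing_def by (metis less_irrefl)
  qed
  moreover have "\<not> l < i"
  proof
    assume "l < i"
    then have "p l = t l" using less by auto
    then show False using assms(2) \<open>l < i\<close> less.prems l unfolding increasing_def by (metis less_irrefl)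
  qed
  ultimately have "t i \<le> t j" "p i \<le> p l"
    using assms(1,2) j(1) l(1) unfolding increasing_def by (metis le_less linorder_neqE_nat)+
  then show ?case using j l by simp
qed

section \<open>Row operations and expansion of path determinants\<close>

lemma det_row_sum:
  fixes f :: "nat \<Rightarrow> nat \<Rightarrow> 'k::comm_ring_1"
  assumes "e < d"
  shows "det (mat d d (\<lambda>(i,k). if i = e then u k + v k else f i k)) =
         det (mat d d (\<lambda>(i,k). if i = e then u k else f i k)) +
         det (mat d d (\<lambda>(i,k). if i = e then v k else f i k))"
proof -
  have eq: "mat\<^sub>r d d (\<lambda>i. if i = e then vec d w else vec d (f i)) =
        mat d d (\<lambda>(i,k). if i = e then w k else f i k)" for w :: "nat \<Rightarrow> 'k"
    by (rule eq_matI) auto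
  have add: "vec d u + vec d v = vec d (\<lambda>k. u k + v k)" by (rule eq_vecI) auto
  have "det (mat\<^sub>r d d (\<lambda>i. if i = e then vec d (\<lambda>k. u k + v k) else vec d (f i))) =
      det (mat\<^sub>r d d (\<lambda>i. if i = e then vec d u else vec d (f i))) +
      det (mat\<^sub>r d d (\<lambda>i. if i = e then vec d v else vec d (f i)))"
    using det_row_add[of "\<lambda>_. vec d u" e d "\<lambda>_. vec d v" "\<lambda>i. vec d (f i)"] assms
    unfolding add by auto
  then show ?thesis unfolding eq .
qed

text \<open>Splitting the zero row as \<open>0 + 0\<close> gives
  \<open>det = det + det\<close>.\<close>

lemma det_row_zero:
  fixes f :: "nat \<Rightarrow> nat \<Rightarrow> 'k::comm_ring_1"
  assumes "e < d" "\<And>k. k < d \<Longrightarrow> f e k = 0"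
  shows "det (mat d d (\<lambda>(i,k). f i k)) = 0"
proof -
  have "mat d d (\<lambda>(i,k). f i k) = mat d d (\<lambda>(i,k). if i = e then 0 + 0 else f i k)"
    by (rule eq_matI) (auto simp: assms)
  also have "det \<dots> = det (mat d d (\<lambda>(i,k). f i k)) + det (mat d d (\<lambda>(i,k). f i k))"
  proof -
    have "mat d d (\<lambda>(i,k). if i = e then 0 else f i k) = mat d d (\<lambda>(i,k). f i k)"
      by (rule eq_matI) (auto simp: assms)
    then show ?thesis by (subst det_row_sum[OF assms(1)]) simp
  qed
  finally show ?thesis by simp
qed

text \<open>Expanding the determinant row by row moves the paths one at a time. Since a step changes a position by
  \<open>0\<close> or \<open>1\<close>, a term that destroys the strict order has two equal rows and vanishes; so no signs occur.\<close>

lemma path_determinant: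
  assumes "increasing d t" "increasing d p"
  shows "\<exists>N. det (mat d d (\<lambda>(i,k). path_count stay move r (p i) (t k))) = (of_nat N :: 'k::comm_ring_1) \<and>
             (disjoint_paths stay move d t r p \<longrightarrow> 0 < N)"
  using assms(2)
proof (induction r arbitrary: p)
  case 0
  let ?A = "mat d d (\<lambda>(i,k). path_count stay move 0 (p i) (t k)) :: 'k mat"
  show ?case
  \<comment> \<open>Without remaining steps the matrix compares sources with targets: it is the
    identity if the two sets agree; otherwise some source is not a target and its row is
    zero.\<close>
  proof (cases "p ` {..<d} = t ` {..<d}")
    case True
    have "?A = 1\<^sub>m d"
    proof (rule eq_matI)
      fix i k assume "i < dim_row (1\<^sub>m d :: 'k mat)" "k < dim_col (1\<^sub>m d :: 'k mat)"
      then have ik: "i < d" "k < d" by auto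
      have "t i = t k \<longleftrightarrow> i = k"
        using assms(1) ik unfolding increasing_def by (metis less_irrefl linorder_neqE_nat)
      then show "?A $$ (i,k) = 1\<^sub>m d $$ (i,k)"
        using increasing_image_eq[OF 0 assms(1) True] ik by simp
    qed auto
    then have "det ?A = of_nat 1" by simp
    then show ?thesis by (intro exI[of _ 1]) auto
  next
    case False
    have "card (p ` {..<d}) = d" "card (t ` {..<d}) = d"
      using 0 assms(1) unfolding increasing_def
      by (auto intro!: card_image[where A = "{..<d}", simplified] simp: inj_on_def)
         (metis less_irrefl linorder_neqE_nat)+
    then have "\<not> p ` {..<d} \<subseteq> t ` {..<d}" using False
      by (metis card_subset_eq finite_imageI finite_lessThan)
    then obtain e where e: "e < d" "\<And>k. k < d \<Longrightarrow> p e \<noteq> t k" by blast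
    then have "det ?A = of_nat 0" using det_row_zero[of e d "\<lambda>i k. path_count stay move 0 (p i) (t k)"] by simp
    moreover have "\<not> disjoint_paths stay move d t 0 p" using False by auto
    ultimately show ?thesis by blast
  qed
next
  case (Suc r)
  let ?h = "\<lambda>r x k. path_count stay move r x (t k) :: 'k"
  \<comment> \<open>Interpolates between \<open>r\<close> and \<open>Suc r\<close> remaining steps:
    in \<open>mixed e q\<close> the rows from \<open>e\<close> on have already made the step.
    Correspondingly \<open>good e q\<close> speaks of families in which only the first
    \<open>e\<close> paths still make it.\<close>
  define mixed where "mixed e q = mat d d (\<lambda>(i,k). if i < e then ?h (Suc r) (q i) k else ?h r (q i) k)" for e q
  define good where "good e q \<longleftrightarrow> (\<exists>p'. increasing d p' \<and>
      (\<forall>i<d. if i < e then allowed_step stay move (Suc r) (q i) (p' i) else p' i = q i) \<and>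
      disjoint_paths stay move d t r p')" for e q
  have "\<exists>N. det (mixed e q) = of_nat N \<and> (good e q \<longrightarrow> 0 < N)" if "increasing d q" "e \<le> d" for e q
    using that
  proof (induction e arbitrary: q)
    case 0
    obtain N where N: "det (mixed 0 q) = of_nat N" "disjoint_paths stay move d t r q \<longrightarrow> 0 < N"
      using Suc.IH[OF 0(1)] unfolding mixed_def by auto
    have cong: "disjoint_paths stay move d t r q" if "\<forall>i<d. p' i = q i" "disjoint_paths stay move d t r p'" for p'
      using that by (cases r) auto
    have "good 0 q \<longrightarrow> disjoint_paths stay move d t r q"
      unfolding good_def using cong by auto
    then show ?case using N by blast
  next
    case (Suc e)
    let ?q' = "q(e := q e + 1)"
    have ed: "e < d" using Suc.prems by simp
    obtain N where N: "det (mixed e q) = of_nat N" "good e q \<longrightarrow> 0 < N"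
      using Suc.IH[of q] Suc.prems by auto
    have "\<exists>N'. det (mixed e ?q') = of_nat N' \<and> (good e ?q' \<longrightarrow> 0 < N')"
    proof (cases "increasing d ?q'")
      case True
      then show ?thesis using Suc.IH[OF True less_imp_le[OF ed]] by blast
    next
      case False
      then obtain i j where ij: "i < j" "j < d" "\<not> ?q' i < ?q' j" unfolding increasing_def by blast
      then have [simp]: "i = e" using Suc.prems(1) unfolding increasing_def
        by (metis fun_upd_apply less_irrefl zless_add1_eq)
      have "q e < q j" using Suc.prems(1) ij unfolding increasing_def by auto
      \<comment> \<open>The advanced path can only collide with a path standing exactly at
        \<open>q e + 1\<close>; both rows then have \<open>r\<close> remaining steps and
        coincide.\<close>
      then have qj: "q j = q e + 1" using ij by auto
      have "det (mixed e ?q') = 0"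
      proof (rule det_identical_rows[of _ d e j])
        show "row (mixed e ?q') e = row (mixed e ?q') j"
          using ij ed qj by (intro eq_vecI) (auto simp: mixed_def)
      qed (use ij ed in \<open>auto simp: mixed_def\<close>)
      moreover have "\<not> good e ?q'"
      proof
        assume "good e ?q'"
        then obtain p' where p': "increasing d p'" "p' e = ?q' e" "p' j = ?q' j"
          unfolding good_def using ij ed by fastforce
        then show False using ij qj unfolding increasing_def by fastforce
      qed
      ultimately show ?thesis by (intro exI[of _ 0]) auto
    qed
    then obtain N' where N': "det (mixed e ?q') = of_nat N'" "good e ?q' \<longrightarrow> 0 < N'" by blast
    let ?f = "\<lambda>i k. if i < e then ?h (Suc r) (q i) k else ?h r (q i) k"
    have row: "det (mat d d (\<lambda>(i,k). if i = e then (if b then ?h r x k else 0) else ?f i k)) =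
        (if b then det (mixed e (q(e := x))) else 0)" for b x
    proof (cases b)
      case True
      then show ?thesis unfolding mixed_def
        by (auto intro!: arg_cong[where f = det] eq_matI)
    next
      case False
      then show ?thesis using det_row_zero[of e d "\<lambda>i k. if i = e then (if b then ?h r x k else 0) else ?f i k"] ed
        by simp
    qed
    \<comment> \<open>The choice of path \<open>e\<close> between staying and moving splits the
      determinant into two of the previous kind. Both are natural numbers, so nothing cancels and
      positivity of one suffices.\<close>
    have "mixed (Suc e) q = mat d d (\<lambda>(i,k). if i = e then
            (if stay (Suc r) (q e) then ?h r (q e) k else 0) + (if move (Suc r) (q e) then ?h r (q e + 1) k else 0)
            else ?f i k)"
      unfolding mixed_def by (rule eq_matI) (auto simp: less_Suc_eq)
    then have "det (mixed (Suc e) q) = (if stay (Suc r) (q e) then det (mixed e q) else 0) +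
        (if move (Suc r) (q e) then det (mixed e ?q') else 0)"
      using det_row_sum[OF ed, of "\<lambda>k. if stay (Suc r) (q e) then ?h r (q e) k else 0"
          "\<lambda>k. if move (Suc r) (q e) then ?h r (q e + 1) k else 0" ?f]
      by (simp only: row fun_upd_triv)
    also have "\<dots> = of_nat ((if stay (Suc r) (q e) then N else 0) + (if move (Suc r) (q e) then N' else 0))"
      using N N' by simp
    finally have det: "det (mixed (Suc e) q) = \<dots>" .
    have "(stay (Suc r) (q e) \<and> good e q) \<or> (move (Suc r) (q e) \<and> good e ?q')" if "good (Suc e) q"
    proof -
      from that obtain p' where p': "increasing d p'" "disjoint_paths stay move d t r p'"
        "\<And>i. i < d \<Longrightarrow> if i < Suc e then allowed_step stay move (Suc r) (q i) (p' i) else p' i = q i"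
        unfolding good_def by blast
      have other: "if i < e then allowed_step stay move (Suc r) (q i) (p' i) else p' i = q i"
        if "i < d" "i \<noteq> e" for i
        using p'(3)[OF that(1)] that by (auto split: if_splits simp: less_Suc_eq)
      have "allowed_step stay move (Suc r) (q e) (p' e)" using p'(3)[OF ed] by simp
      then consider "p' e = q e" "stay (Suc r) (q e)" | "p' e = q e + 1" "move (Suc r) (q e)"
        unfolding allowed_step_def by blast
      then show ?thesis
      proof cases
        case 1
        then have "good e q" unfolding good_def using p'(1,2) other by (metis less_irrefl)
        then show ?thesis using 1 by blast
      next
        case 2
        then have "good e ?q'" unfolding good_def using p'(1,2) other
          by (intro exI[of _ p']) (auto split: if_splits)
        then show ?thesis using 2 by blast
      qed
    qed
    then have "good (Suc e) q \<longrightarrow> 0 < (if stay (Suc r) (q e) then N else 0) + (if move (Suc r) (q e) then N' else 0)"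
      using N N' by auto
    then show ?case using det by blast
  qed
  from this[OF Suc.prems order.refl]
  obtain N where N: "det (mixed d p) = of_nat N" "good d p \<longrightarrow> 0 < N" by blast
  have "mixed d p = mat d d (\<lambda>(i,k). ?h (Suc r) (p i) k)" unfolding mixed_def by (rule eq_matI) auto
  moreover have "disjoint_paths stay move d t (Suc r) p \<Longrightarrow> good d p" unfolding good_def by auto
  ultimately show ?case using N by metis
qed

text \<open>A disjoint family makes the determinant a positive natural number, which is nonzero in
  characteristic zero.\<close>

lemma path_matrix_right_kernel:
  fixes g :: "nat \<Rightarrow> 'k::field_char_0"
  assumes "increasing d t" "increasing d p" "disjoint_paths stay move d t r p"
    and "\<And>i. i < d \<Longrightarrow> (\<Sum>k<d. path_count stay move r (p i) (t k) * g k) = 0" and "k < d"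
  shows "g k = 0"
proof -
  let ?A = "mat d d (\<lambda>(i,k). path_count stay move r (p i) (t k)) :: 'k mat"
  have A: "?A \<in> carrier_mat d d" by simp
  have "det ?A \<noteq> 0"
    using path_determinant[OF assms(1,2), of stay move r, where 'k = 'k] assms(3) by auto
  moreover have "?A *\<^sub>v vec d g = 0\<^sub>v d"
    using assms(4) by (intro eq_vecI) (auto simp: scalar_prod_def lessThan_atLeast0)
  ultimately have "vec d g = 0\<^sub>v d"
    using det_0_iff_vec_prod_zero_field[OF A] vec_carrier by metis
  then have "vec d g $ k = 0\<^sub>v d $ k" by simp
  then show ?thesis using assms(5) by simp
qed

text \<open>The same argument for the transposed matrix, which has the same determinant.\<close>

lemma path_matrix_left_kernel:
  fixes w :: "nat \<Rightarrow> 'k::field_char_0"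
  assumes "increasing d t" "increasing d p" "disjoint_paths stay move d t r p"
    and "\<And>k. k < d \<Longrightarrow> (\<Sum>i<d. w i * path_count stay move r (p i) (t k)) = 0" and "i < d"
  shows "w i = 0"
proof -
  let ?A = "mat d d (\<lambda>(i,k). path_count stay move r (p i) (t k)) :: 'k mat"
  have A: "transpose_mat ?A \<in> carrier_mat d d" by simp
  have "det (transpose_mat ?A) \<noteq> 0"
    using path_determinant[OF assms(1,2), of stay move r, where 'k = 'k] assms(3) det_transpose[of ?A d] by auto
  moreover have "transpose_mat ?A *\<^sub>v vec d w = 0\<^sub>v d"
    using assms(4) by (intro eq_vecI) (auto simp: scalar_prod_def lessThan_atLeast0 mult.commute)
  ultimately have "vec d w = 0\<^sub>v d"
    using det_0_iff_vec_prod_zero_field[OF A] vec_carrier by metis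
  then have "vec d w $ i = 0\<^sub>v d $ i" by simp
  then show ?thesis using assms(5) by simp
qed

section \<open>Explicit path families and the pairing of flows with path counts\<close>

lemma disjoint_pathsI:
  assumes "\<And>s. s \<le> r \<Longrightarrow> increasing d (pos s)"
    and "\<And>s i. s < r \<Longrightarrow> i < d \<Longrightarrow> allowed_step stay move (Suc s) (pos (Suc s) i) (pos s i)"
    and "\<And>i. i < d \<Longrightarrow> pos 0 i = t i"
  shows "disjoint_paths stay move d t r (pos r)"
  using assms(1,2)
proof (induction r)
  case 0
  then show ?case using assms(3) by simp
next
  case (Suc r)
  have "disjoint_paths stay move d t r (pos r)" using Suc.prems by (intro Suc.IH) auto
  then show ?case using Suc.prems by (auto intro!: exI[of _ "pos r"])
qed

text \<open>Discrete summation by parts: each step moves the recursion of \<open>path_count\<close>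
  onto the flow, so the pairing does not depend on \<open>r\<close>, and at \<open>r = 0\<close> it
  picks out the value at \<open>t\<close>.\<close>

lemma path_count_pairing:
  fixes G :: "nat \<Rightarrow> int \<Rightarrow> 'k::comm_ring_1"
  assumes supp: "\<And>r p. G r p \<noteq> 0 \<Longrightarrow> lo < p \<and> p < hi"
    and flow: "\<And>r p. r < R \<Longrightarrow> G r p = (if stay (Suc r) p then G (Suc r) p else 0) +
                   (if move (Suc r) (p - 1) then G (Suc r) (p - 1) else 0)"
    and "r \<le> R"
  shows "(\<Sum>p\<in>{lo..hi}. G r p * path_count stay move r p t) = G 0 t"
  using \<open>r \<le> R\<close>
proof (induction r)
  case 0
  have "(\<Sum>p\<in>{lo..hi}. G 0 p * path_count stay move 0 p t) = (\<Sum>p\<in>{lo..hi}. if p = t then G 0 t else 0)"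
    by (rule sum.cong) auto
  also have "\<dots> = G 0 t" using supp[of 0 t] by (cases "G 0 t = 0") auto
  finally show ?case .
next
  case (Suc r)
  let ?h = "\<lambda>p. path_count stay move r p t"
  let ?m = "\<lambda>p. if move (Suc r) p then G (Suc r) p else 0"
  have "(\<Sum>p\<in>{lo..hi}. ?m p * ?h (p + 1)) = (\<Sum>p\<in>{lo+1..hi+1}. ?m (p - 1) * ?h p)"
    by (rule sum.reindex_bij_witness[of _ "\<lambda>p. p - 1" "\<lambda>p. p + 1"]) auto
  also have "\<dots> = (\<Sum>p\<in>{lo..hi}. ?m (p - 1) * ?h p)"
  proof (rule sum.mono_neutral_cong)
    \<comment> \<open>The strict bounds on the support make the summands at both ends of the shifted
      interval vanish.\<close>
    show "?m (p - 1) * ?h p = 0" if "p \<in> {lo..hi} - {lo+1..hi+1}" for p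
      using supp[of "Suc r" "p - 1"] that by (cases "G (Suc r) (p - 1) = 0") auto
    show "?m (p - 1) * ?h p = 0" if "p \<in> {lo+1..hi+1} - {lo..hi}" for p
      using supp[of "Suc r" "p - 1"] that by (cases "G (Suc r) (p - 1) = 0") auto
  qed auto
  finally have shift: "(\<Sum>p\<in>{lo..hi}. ?m p * ?h (p + 1)) = (\<Sum>p\<in>{lo..hi}. ?m (p - 1) * ?h p)" .
  have "(\<Sum>p\<in>{lo..hi}. G (Suc r) p * path_count stay move (Suc r) p t) =
      (\<Sum>p\<in>{lo..hi}. (if stay (Suc r) p then G (Suc r) p else 0) * ?h p) + (\<Sum>p\<in>{lo..hi}. ?m p * ?h (p + 1))"
    unfolding sum.distrib[symmetric] by (rule sum.cong) (auto simp: algebra_simps)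
  also have "\<dots> = (\<Sum>p\<in>{lo..hi}. G r p * ?h p)"
    unfolding shift sum.distrib[symmetric]
    using flow[of r] Suc.prems by (intro sum.cong) (auto simp: algebra_simps)
  also have "\<dots> = G 0 t" using Suc by simp
  finally show ?case .
qed

section \<open>Lattice paths in two boxes\<close>

text \<open>The boxes contain the exponents of the divisors of the two socle monomials, and
  \<open>D\<close> is the degree where the multiplication starts. The \<open>z\<close>-exponents are
  naturals because they bound numbers of steps.\<close>

locale two_boxes =
  fixes a1 b1 a2 b2 :: int and c1 c2 :: nat and D :: int
  assumes nonneg: "0 \<le> a2" "0 \<le> b2"
    and le: "a2 \<le> a1" "b2 \<le> b1" "c1 \<le> c2"
    and deg: "a1 + b1 + int c1 = a2 + b2 + int c2"
begin

text \<open>With integer exponents a neighbour of a monomial may leave the region without side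
  conditions; functions on the region are extended by zero.\<close>

definition region :: "int \<Rightarrow> int \<Rightarrow> int \<Rightarrow> bool" where
  "region i j l \<longleftrightarrow> 0 \<le> i \<and> 0 \<le> j \<and> 0 \<le> l \<and>
     ((i \<le> a1 \<and> j \<le> b1 \<and> l \<le> int c1) \<or> (i \<le> a2 \<and> j \<le> b2 \<and> l \<le> int c2))"

text \<open>With \<open>r\<close> steps to go, position \<open>p\<close> stands for the monomial \<open>x\<^sup>p y\<^sup>q\<close> of degree \<open>D + 1 - r\<close>; staying is
  multiplication by \<open>y\<close>, moving is multiplication by \<open>x\<close>. While \<open>r > c1 + 1\<close>, the points outside the small box
  are fictitious: they prolong the additional sources backwards along a horizontal or vertical ray, so
  that all paths have the same length.\<close>

definition stay :: "nat \<Rightarrow> int \<Rightarrow> bool" where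
  "stay r p \<longleftrightarrow> (let y = D + 1 - int r - p in
     if r \<le> c1 + 1 then y + 1 \<le> b1 else y \<le> b2 \<and> (p > a2 \<or> y + 1 \<le> b2))"

definition move :: "nat \<Rightarrow> int \<Rightarrow> bool" where
  "move r p \<longleftrightarrow> (let y = D + 1 - int r - p in
     if r \<le> c1 + 1 then p + 1 \<le> a1 else y > b2 \<or> p + 1 \<le> a2)"

abbreviation "paths \<equiv> path_count stay move"

text \<open>The \<open>x\<close>-exponents of the monomials without \<open>z\<close> in degree
  \<open>D + 1\<close>, where the paths end.\<close>

definition target :: "int \<Rightarrow> bool" where
  "target p \<longleftrightarrow> max 0 (D + 1 - b1) \<le> p \<and> p \<le> min a1 (D + 1)"

text \<open>The three cases are the small box in degree \<open>D - c2\<close> and the starting points of the fictitious rays that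
  end, in degree \<open>D - c1\<close>, to the left and to the right of the small box.\<close>

definition source :: "int \<Rightarrow> bool" where
  "source p \<longleftrightarrow>
     (max 0 (D - int c2 - b2) \<le> p \<and> p \<le> min a2 (D - int c2)) \<or>
     (let p' = p + int (c2 - c1) in
        max 0 (D - int c1 - b1) \<le> p' \<and> p' \<le> min a1 (D - int c1) \<and> p' < D - int c1 - b2) \<or>
     (max 0 (D - int c1 - b1) \<le> p \<and> p \<le> min a1 (D - int c1) \<and> D - int c1 - b2 \<le> p \<and> a2 < p)"

text \<open>The paths go from \<open>\<sigma>\<close> via \<open>\<rho>\<close> (at the change of boxes) to \<open>t\<close>, in each phase first moving and then staying.\<close>

lemma path_familyI:
  fixes \<sigma> \<rho> t :: "nat \<Rightarrow> int"
  assumes inc: "increasing d \<sigma>" "increasing d \<rho>" "increasing d t"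
    and T: "\<And>i. i < d \<Longrightarrow> D + 1 - b1 \<le> t i \<and> t i \<le> a1"
    and two: "\<And>i. i < d \<Longrightarrow> 0 \<le> t i - \<rho> i \<and> t i - \<rho> i \<le> int c1 + 1"
    and one: "\<And>i. i < d \<Longrightarrow>
       (\<rho> i = \<sigma> i + int (c2 - c1) \<and> \<rho> i < D - int c1 - b2) \<or>
       (\<rho> i = \<sigma> i \<and> a2 < \<rho> i \<and> D - int c1 - b2 \<le> \<rho> i) \<or>
       (0 \<le> \<rho> i - \<sigma> i \<and> \<rho> i - \<sigma> i \<le> int (c2 - c1) \<and> \<rho> i \<le> a2 \<and> D - int c1 - b2 \<le> \<rho> i)"
  shows "disjoint_paths stay move d t (c2 + 1) \<sigma>"
proof -
  \<comment> \<open>Since \<open>r\<close> counts down, the branch \<open>r \<le> c1 + 1\<close> is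
    the later phase, in the large box.\<close>
  define pos where "pos r i = (if r \<le> c1 + 1 then min (\<rho> i + (int c1 + 1 - int r)) (t i)
     else min (\<sigma> i + (int c2 + 1 - int r)) (\<rho> i))" for r i
  have "disjoint_paths stay move d t (c2 + 1) (pos (c2 + 1))"
  proof (rule disjoint_pathsI)
    fix s
    show "increasing d (pos s)"
      using inc unfolding increasing_def pos_def by (auto simp: min_def) (smt (verit))+
  next
    fix s i assume s: "s < c2 + 1" and i: "i < d"
    note facts = T[OF i] two[OF i] one[OF i]
    consider "s < c1 + 1" | "s = c1 + 1" | "c1 + 1 < s" by linarith
    then show "allowed_step stay move (Suc s) (pos (Suc s) i) (pos s i)"
    proof cases
      case 1
      then show ?thesis using facts s
        unfolding allowed_step_def pos_def stay_def move_def Let_def by (auto simp: min_def)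
    next
      \<comment> \<open>The last step of the first phase: it still obeys the rule for
        \<open>r > c1 + 1\<close> and arrives at \<open>\<rho>\<close>, because at most
        \<open>c2 - c1\<close> moves lead there from \<open>\<sigma>\<close>.\<close>
      case 2
      then have "pos s i = \<rho> i" using facts unfolding pos_def by simp
      moreover have "pos (Suc s) i = min (\<sigma> i + (int c2 - int c1 - 1)) (\<rho> i)" using 2 unfolding pos_def by simp
      ultimately show ?thesis using facts s 2 le(3)
        unfolding allowed_step_def stay_def move_def Let_def by (auto simp: min_def of_nat_diff)
    next
      case 3
      then have "pos s i = min (\<sigma> i + (int c2 + 1 - int s)) (\<rho> i)"
        "pos (Suc s) i = min (\<sigma> i + (int c2 - int s)) (\<rho> i)" unfolding pos_def by simp_all
      then show ?thesis using facts s 3 le(3)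
        unfolding allowed_step_def stay_def move_def Let_def by (auto simp: min_def of_nat_diff)
    qed
  next
    fix i assume "i < d"
    then show "pos 0 i = t i" using two[of i] unfolding pos_def by simp
  qed
  moreover have "pos (c2 + 1) i = \<sigma> i" if "i < d" for i
    using one[OF that] two[OF that] le(3) unfolding pos_def by (auto simp: min_def of_nat_diff)
  moreover have "disjoint_paths stay move d t (c2 + 1) \<sigma>"
    if "disjoint_paths stay move d t (c2 + 1) p" "\<And>i. i < d \<Longrightarrow> p i = \<sigma> i" for p
    using that by simp
  ultimately show ?thesis by blast
qed

text \<open>At the change of boxes the paths form a left block starting at \<open>lP\<close> and a
  right block ending at \<open>hP\<close>; they lead to the first and to the last targets. Between
  the change and the targets both ends of the range shift by an amount from \<open>0\<close> to
  \<open>c1 + 1\<close>, so each block can be carried over rigidly.\<close>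

lemma path_family:
  obtains d \<sigma> t where "increasing d \<sigma>" "increasing d t" "disjoint_paths stay move d t (c2 + 1) \<sigma>"
    "\<And>i. i < d \<Longrightarrow> target (t i)" "\<And>i. i < d \<Longrightarrow> source (\<sigma> i)"
    "(\<forall>p. target p \<longrightarrow> (\<exists>i<d. t i = p)) \<or> (\<forall>p. source p \<longrightarrow> (\<exists>i<d. \<sigma> i = p))"
proof -
  \<comment> \<open>\<open>n\<close> is the \<open>(x,y)\<close>-degree at the change of boxes and
    \<open>\<delta>\<close> the length of the first phase. Below, \<open>lP..hP\<close> are the
    positions of the large box at the change, \<open>lT..hT\<close> the targets, and
    \<open>s0..s1\<close> the sources in the small box.\<close>
  define n where "n = D - int c1"
  define \<delta> where "\<delta> = int (c2 - c1)"
  have \<delta>: "0 \<le> \<delta>" "\<delta> = a1 + b1 - a2 - b2" "D - int c2 = n - \<delta>" using le deg by (auto simp: \<delta>_def n_def of_nat_diff)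
  define lP where "lP = max 0 (n - b1)"
  define hP where "hP = min a1 n"
  define lT where "lT = max 0 (D + 1 - b1)"
  define hT where "hT = min a1 (D + 1)"
  have target: "target p \<longleftrightarrow> lT \<le> p \<and> p \<le> hT" for p unfolding target_def lT_def hT_def ..
  define s0 where "s0 = max 0 (n - \<delta> - b2)"
  define s1 where "s1 = min a2 (n - \<delta>)"
  have source: "source p \<longleftrightarrow> (s0 \<le> p \<and> p \<le> s1) \<or> (lP \<le> p + \<delta> \<and> p + \<delta> \<le> hP \<and> p + \<delta> < n - b2) \<or>
      (lP \<le> p \<and> p \<le> hP \<and> n - b2 \<le> p \<and> a2 < p)" for p
    unfolding source_def s0_def s1_def lP_def hP_def \<delta>_def[symmetric] \<delta>(3) n_def[symmetric] Let_def ..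
  show ?thesis
  proof (cases "lP \<le> hP")
    case False
    \<comment> \<open>An empty range at the change means a negative degree, where there are no
      sources, or one above the top degree, where there are no targets; the empty family then
      suffices.\<close>
    then have "n < 0 \<or> a1 + b1 < n" using nonneg le unfolding lP_def hP_def by (auto simp: max_def min_def split: if_splits)
    then have "(\<forall>p. \<not> target p) \<or> (\<forall>p. \<not> source p)"
    proof
      assume "n < 0"
      then have "\<not> source p" for p using \<delta>(1) unfolding source s0_def s1_def lP_def hP_def by auto
      then show ?thesis by blast
    next
      assume "a1 + b1 < n"
      then have "\<not> target p" for p unfolding target lT_def hT_def n_def by auto
      then show ?thesis by blast
    qed
    moreover have "disjoint_paths stay move 0 \<sigma> (c2 + 1) \<sigma>" for \<sigma>
      by (rule path_familyI[where \<rho> = \<sigma>]) (auto simp: increasing_def)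
    ultimately show ?thesis using that[of 0 "\<lambda>_. 0" "\<lambda>_. 0"] by (auto simp: increasing_def)
  next
    case True
    have TP: "0 \<le> lT - lP" "lT - lP \<le> int c1 + 1" "0 \<le> hT - hP" "hT - hP \<le> int c1 + 1"
      unfolding lT_def lP_def hT_def hP_def n_def by auto
    \<comment> \<open>The positions at the change split into \<open>lP..U-1\<close>, left of the
      small box and reached by left rays, \<open>U..V\<close> in the small box, and
      \<open>V+1..hP\<close>, reached by right rays.\<close>
    define U where "U = min (hP + 1) (max lP (n - b2))"
    define V where "V = max (U - 1) (min hP a2)"
    \<comment> \<open>The \<open>q\<close> small-box sources compete for \<open>w\<close> positions,
      so \<open>q0\<close> of them are usable. Then \<open>\<tau>\<close> counts the targets,
      \<open>d\<close> the paths and \<open>x\<close> the paths of the left block.\<close>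
    define q where "q = max 0 (s1 - s0 + 1)"
    define w where "w = V - U + 1"
    define q0 where "q0 = min q w"
    define \<tau> where "\<tau> = max 0 (hT - lT + 1)"
    define d where "d = min \<tau> (U - lP + q0 + (hP - V))"
    define x where "x = min d (U - lP + q0)"
    have U: "lP \<le> U" "U \<le> hP + 1" and V: "U - 1 \<le> V" "V \<le> hP"
      using True unfolding U_def V_def by auto
    have U1: "lP < U \<Longrightarrow> U \<le> n - b2" and U2: "U \<le> hP \<Longrightarrow> n - b2 \<le> U" unfolding U_def by auto
    have V1: "V < hP \<Longrightarrow> a2 \<le> V" and V2: "U \<le> V \<Longrightarrow> V \<le> a2" unfolding V_def by auto
    have w0: "0 \<le> w" using V unfolding w_def by simp
    have q0: "0 \<le> q0" "q0 \<le> w" "q0 \<le> q" using w0 unfolding q0_def q_def by auto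
    have d: "0 \<le> d" "d \<le> \<tau>" "d \<le> U - lP + q0 + (hP - V)" using U V q0 unfolding d_def \<tau>_def by auto
    have x: "0 \<le> x" "x \<le> d" "x \<le> U - lP + q0" "d - x \<le> hP - V" using d q0 U V unfolding x_def by auto
    \<comment> \<open>The small-box sources from \<open>s0\<close> on are sent to the positions from
      \<open>U\<close> on. Both are left ends of the small box, in degrees that differ by
      \<open>\<delta>\<close>, which bounds the shift.\<close>
    have Us: "0 \<le> U - s0" "U - s0 \<le> \<delta>" if "0 < q0"
    proof -
      have "U \<le> V" "s0 \<le> s1" using that q0 unfolding w_def q_def by auto
      then have "U = max lP (n - b2)" using V unfolding U_def by auto
      then have "U = max 0 (n - b2)" using le unfolding lP_def by auto
      then show "0 \<le> U - s0" "U - s0 \<le> \<delta>" using \<delta>(1) unfolding s0_def by auto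
    qed
    have s0: "n - \<delta> - b2 \<le> s0" and s1: "s1 \<le> a2" unfolding s0_def s1_def by auto
    define \<rho> where "\<rho> i = (if int i < x then lP + int i else hP - (d - 1 - int i))" for i
    define t where "t i = (if int i < x then lT + int i else hT - (d - 1 - int i))" for i
    \<comment> \<open>A left ray moves throughout the first phase, so it starts
      \<open>\<delta>\<close> further left; a right ray only stays, so it starts where it
      ends.\<close>
    define \<sigma> where "\<sigma> i = (if int i \<ge> x then hP - (d - 1 - int i)
        else if int i < U - lP then lP + int i - \<delta> else s0 + (int i - (U - lP)))" for i
    have inc\<rho>: "increasing (nat d) \<rho>"
      using d x q0 U V unfolding increasing_def \<rho>_def w_def by auto
    have inct: "increasing (nat d) t"
      using d x unfolding increasing_def t_def \<tau>_def by auto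
    have inc\<sigma>: "increasing (nat d) \<sigma>"
      unfolding increasing_def
    proof (intro allI impI)
      fix i j assume ij: "i < j \<and> j < nat d"
      have q0pos: "0 < q0" if "U - lP \<le> int j" "int j < x" using that x by auto
      have q0pos': "0 < q0" if "U - lP \<le> int i" "int i < x" using that x by auto
      \<comment> \<open>The cases record in which of the three groups, left rays, small-box sources
        and right block, the two indices lie.\<close>
      consider "int i \<ge> x" | "int i < x" "int j \<ge> x" "int i < U - lP" | "int i < x" "int j \<ge> x" "int i \<ge> U - lP"
        | "int j < x" "int j < U - lP" | "int j < x" "int i < U - lP" "U - lP \<le> int j" | "int j < x" "int i \<ge> U - lP"
        by linarith
      then show "\<sigma> i < \<sigma> j"
      proof cases
        case 2 then show ?thesis using ij x V \<delta>(1) unfolding \<sigma>_def by auto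
      next
        case 3 
        then have "s0 + (int i - (U - lP)) \<le> s1" using x q0 q0pos' unfolding q_def by auto
        moreover have "V < hP - (d - 1 - int j)" "V < hP" using 3 ij x by auto
        ultimately show ?thesis using 3 ij s1 V1 unfolding \<sigma>_def by auto
      next
        case 5 
        then have "U \<le> n - b2" using U1 by auto
        then show ?thesis using 5 ij s0 unfolding \<sigma>_def by auto
      qed (use ij in \<open>auto simp: \<sigma>_def\<close>)
    qed
    have kinds: "(\<rho> i = \<sigma> i + \<delta> \<and> \<rho> i < n - b2 \<and> lP \<le> \<rho> i \<and> \<rho> i \<le> hP) \<or>
       (\<rho> i = \<sigma> i \<and> a2 < \<rho> i \<and> n - b2 \<le> \<rho> i \<and> lP \<le> \<rho> i \<and> \<rho> i \<le> hP) \<or>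
       (0 \<le> \<rho> i - \<sigma> i \<and> \<rho> i - \<sigma> i \<le> \<delta> \<and> \<rho> i \<le> a2 \<and> n - b2 \<le> \<rho> i \<and> s0 \<le> \<sigma> i \<and> \<sigma> i \<le> s1)"
      if "i < nat d" for i
    proof -
      consider "int i \<ge> x" | "int i < x" "int i < U - lP" | "int i < x" "int i \<ge> U - lP" by linarith
      then show ?thesis
      proof cases
        case 1
        then have "V < hP - (d - 1 - int i)" "V < hP" "U \<le> hP" using that x V by auto
        then show ?thesis using 1 that V U V1 U2 unfolding \<rho>_def \<sigma>_def by auto
      next
        case 2
        then show ?thesis using U U1 unfolding \<rho>_def \<sigma>_def by auto
      next
        case 3
        then have "0 < q0" "int i - (U - lP) < q0" using x by auto
        moreover have "U \<le> V" using \<open>0 < q0\<close> q0 unfolding w_def by auto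
        ultimately show ?thesis using 3 Us U2 V2 V q0 unfolding \<rho>_def \<sigma>_def w_def q_def by auto
      qed
    qed
    have P: "disjoint_paths stay move (nat d) t (c2 + 1) \<sigma>"
    proof (rule path_familyI[OF inc\<sigma> inc\<rho> inct])
      fix i assume i: "i < nat d"
      show "D + 1 - b1 \<le> t i \<and> t i \<le> a1" using i d x unfolding t_def lT_def hT_def \<tau>_def by auto
      show "0 \<le> t i - \<rho> i \<and> t i - \<rho> i \<le> int c1 + 1" using TP unfolding t_def \<rho>_def by auto
      show "(\<rho> i = \<sigma> i + int (c2 - c1) \<and> \<rho> i < D - int c1 - b2) \<or>
       (\<rho> i = \<sigma> i \<and> a2 < \<rho> i \<and> D - int c1 - b2 \<le> \<rho> i) \<or>
       (0 \<le> \<rho> i - \<sigma> i \<and> \<rho> i - \<sigma> i \<le> int (c2 - c1) \<and> \<rho> i \<le> a2 \<and> D - int c1 - b2 \<le> \<rho> i)"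
        using kinds[OF i] unfolding \<delta>_def[symmetric] n_def[symmetric] by blast
    qed
    have tgt: "target (t i)" if "i < nat d" for i
      using that d x unfolding target t_def \<tau>_def by auto
    have src: "source (\<sigma> i)" if "i < nat d" for i
      using kinds[OF that] unfolding source by auto
    have "(\<forall>p. target p \<longrightarrow> (\<exists>i<nat d. t i = p)) \<or> (\<forall>p. source p \<longrightarrow> (\<exists>i<nat d. \<sigma> i = p))"
    proof (cases "d = \<tau>")
      case True
      have "\<exists>i<nat d. t i = p" if "target p" for p
        using that True unfolding target t_def \<tau>_def by (intro exI[of _ "nat (p - lT)"]) auto
      then show ?thesis by blast
    next
      case False
      then have deq: "d = U - lP + q0 + (hP - V)" and "d < \<tau>" unfolding d_def by auto
      \<comment> \<open>With more small-box sources than positions, the small box would be narrower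
        in degree \<open>n\<close> than in degree \<open>n - \<delta>\<close>. Its widths are
        symmetric and unimodal, so \<open>2 * n > a1 + b1\<close>: the large box is past its middle,
        the targets are at most as many as the positions at the change, and all of them would be
        used.\<close>
      have "q0 = q"
      proof (rule ccontr)
        assume "q0 \<noteq> q"
        then have "w < q" "q0 = w" unfolding q0_def by auto
        then have s: "s0 \<le> s1" "V - U < s1 - s0" using w0 unfolding q_def w_def by auto
        then have n: "0 \<le> n - \<delta>" "n - \<delta> \<le> a2 + b2" using nonneg unfolding s0_def s1_def by auto
        have "min a2 n - max 0 (n - b2) \<le> V - U"
          using n V le nonneg \<delta> unfolding U_def V_def lP_def hP_def by (auto simp: min_def max_def)
        then have "a2 + b2 < 2 * n - \<delta>" using s n \<delta> unfolding s0_def s1_def by (auto simp: min_def max_def split: if_splits)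
        then have "hT - lT \<le> hP - lP" using \<delta> unfolding hT_def lT_def hP_def lP_def n_def
          by (auto simp: min_def max_def)
        then have "\<tau> \<le> hP - lP + 1" using \<open>lP \<le> hP\<close> unfolding \<tau>_def by auto
        then show False using \<open>d < \<tau>\<close> deq \<open>q0 = w\<close> unfolding w_def by auto
      qed
      have xeq: "x = U - lP + q0" using deq V unfolding x_def by auto
      have "\<exists>i<nat d. \<sigma> i = p" if "source p" for p
      proof -
        consider "s0 \<le> p" "p \<le> s1" | "lP \<le> p + \<delta>" "p + \<delta> \<le> hP" "p + \<delta> < n - b2"
          | "lP \<le> p" "p \<le> hP" "n - b2 \<le> p" "a2 < p" using \<open>source p\<close> unfolding source by blast
        then show ?thesis
        proof cases
          case 1
          then show ?thesis using xeq \<open>q0 = q\<close> U x unfolding \<sigma>_def q_def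
            by (intro exI[of _ "nat (p - s0 + (U - lP))"]) auto
        next
          case 2
          then have "p + \<delta> < U" unfolding U_def by auto
          with 2 show ?thesis using xeq q0 U x unfolding \<sigma>_def
            by (intro exI[of _ "nat (p + \<delta> - lP)"]) auto
        next
          case 3
          then have "V < p" unfolding V_def U_def by auto
          with 3 show ?thesis using xeq deq q0 U x unfolding \<sigma>_def
            by (intro exI[of _ "nat (d - 1 - (hP - p))"]) auto
        qed
      qed
      then show ?thesis by blast
    qed
    then show ?thesis using that[OF inc\<sigma> inct P tgt src] by blast
  qed
qed

text \<open>Up to sign, the layers \<open>l = r - 1\<close> of a kernel element are the amounts of a flow along the steps: what
  arrives at a point is the sum of what its predecessors sent.\<close>

lemma kernel_flow:
  fixes f :: "int \<Rightarrow> int \<Rightarrow> int \<Rightarrow> 'k::idom"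
  assumes supp_all: "\<forall>i j l. f i j l \<noteq> 0 \<longrightarrow> region i j l \<and> i + j + l = D"
    and ker_all: "\<forall>i j l. region i j l \<longrightarrow> i + j + l = D + 1 \<longrightarrow> f (i - 1) j l + f i (j - 1) l + f i j (l - 1) = 0"
  shows "\<exists>G :: nat \<Rightarrow> int \<Rightarrow> 'k.
    (\<forall>p. G 0 p = 0) \<and> (\<forall>p. G (c2 + 1) p \<noteq> 0 \<longrightarrow> source p) \<and>
    (\<forall>r p. G r p \<noteq> 0 \<longrightarrow> r \<le> c2 + 1 \<longrightarrow> - int c2 - 2 < p \<and> p < a1 + 1) \<and>
    (\<forall>i j l. f i j l \<noteq> 0 \<longrightarrow> (\<exists>r\<le>c2 + 1. \<exists>p. G r p \<noteq> 0)) \<and>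
    (\<forall>r p. r < c2 + 1 \<longrightarrow> G r p = (if stay (Suc r) p then G (Suc r) p else 0) +
                   (if move (Suc r) (p - 1) then G (Suc r) (p - 1) else 0))"
proof -
  have supp: "region i j l \<and> i + j + l = D" if "f i j l \<noteq> 0" for i j l
    using supp_all that by blast
  have ker: "f (i - 1) j l + f i (j - 1) l + f i j (l - 1) = 0" if "region i j l" "i + j + l = D + 1" for i j l
    using ker_all that by blast
  \<comment> \<open>The alternating sign turns the kernel equation between consecutive layers into a
    sum without signs.\<close>
  define Z where "Z k p = (-1) ^ k * f p (D - int k - p) (int k)" for k :: nat and p
  have Zsupp: "0 \<le> p \<and> 0 \<le> D - int k - p \<and> ((p \<le> a1 \<and> D - int k - p \<le> b1 \<and> k \<le> c1) \<or> (p \<le> a2 \<and> D - int k - p \<le> b2 \<and> k \<le> c2))"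
    if "Z k p \<noteq> 0" for k p
  proof -
    have "f p (D - int k - p) (int k) \<noteq> 0" using that unfolding Z_def by auto
    from supp[OF this] show ?thesis unfolding region_def by auto
  qed
  have Zflow: "Z k p = Z (Suc k) p + Z (Suc k) (p - 1)" if "region p (D - int k - p) (int k + 1)" for k p
  proof -
    have "f (p - 1) (D - int k - p) (int k + 1) + f p (D - int k - p - 1) (int k + 1) + f p (D - int k - p) (int k) = 0"
      using ker[OF that] by simp
    then have eq: "f p (D - int k - p) (int k) = - (f (p - 1) (D - int k - p) (int k + 1) + f p (D - int k - p - 1) (int k + 1))"
      by (simp only: add_eq_0_iff)
    have e: "D - int (Suc k) - (p - 1) = D - int k - p" "D - int (Suc k) - p = D - int k - p - 1"
      "int (Suc k) = int k + 1" by auto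
    show ?thesis unfolding Z_def e eq by (simp add: algebra_simps)
  qed
  \<comment> \<open>At \<open>z\<close>-exponent \<open>0\<close> the third summand lies outside the
    region, so nothing arrives at the targets; this justifies the value \<open>0\<close> of
    \<open>G\<close> at \<open>r = 0\<close>.\<close>
  have Zflow0: "Z 0 p + Z 0 (p - 1) = 0" if "region p (D + 1 - p) 0" for p
  proof -
    have "f p (D + 1 - p) (-1) = 0" using supp[of p "D + 1 - p" "-1"] unfolding region_def by fastforce
    then show ?thesis using ker[OF that] unfolding Z_def by (simp add: algebra_simps)
  qed
  \<comment> \<open>The index \<open>r = k + 1\<close> belongs to the layer of \<open>z ^ k\<close>.
    On a ray the amount is the value of layer \<open>c1\<close> at the end of the ray. The guard
    \<open>D - int c1 - p \<le> b2\<close> removes points whose position at the change belongs to a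
    left ray, so no value is used twice.\<close>
  define G where "G r p = (if r = 0 then 0 else if r \<le> c1 + 1 then Z (r - 1) p
     else let y = D + 1 - int r - p in
       if y > b2 then Z c1 (p + int r - int c1 - 1)
       else if p > a2 then (if D - int c1 - p \<le> b2 then Z c1 p else 0) else Z (r - 1) p)" for r p
  have G0: "G 0 p = 0" for p unfolding G_def by simp
  have G1: "G (Suc k) p = Z k p" if "k \<le> c1" for k p using that unfolding G_def by simp
  have G2: "G (Suc k) p = (if D - int k - p > b2 then Z c1 (p + int k - int c1)
       else if p > a2 then (if D - int c1 - p \<le> b2 then Z c1 p else 0) else Z k p)" if "c1 < k" for k p
    using that unfolding G_def by (simp add: Let_def algebra_simps)
  \<comment> \<open>The formula of the first phase also holds at \<open>k = c1\<close>, which joins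
    the two phases.\<close>
  have G2': "G (Suc k) p = (if D - int k - p > b2 then Z c1 (p + int k - int c1)
       else if p > a2 then (if D - int c1 - p \<le> b2 then Z c1 p else 0) else Z k p)" if "c1 \<le> k" for k p
    using that G1[of k p] G2[of k p] by (cases "k = c1") auto
  have st1: "stay (Suc k) p \<longleftrightarrow> D - int k - p + 1 \<le> b1" and mv1: "move (Suc k) p \<longleftrightarrow> p + 1 \<le> a1" if "k \<le> c1" for k p
    using that unfolding stay_def move_def Let_def by auto
  have st2: "stay (Suc k) p \<longleftrightarrow> D - int k - p \<le> b2 \<and> (p > a2 \<or> D - int k - p + 1 \<le> b2)"
    and mv2: "move (Suc k) p \<longleftrightarrow> D - int k - p > b2 \<or> p + 1 \<le> a2" if "c1 < k" for k p
    using that unfolding stay_def move_def Let_def by auto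
  show ?thesis
  proof (intro exI[of _ G] conjI allI impI)
    show "G 0 p = 0" for p by (rule G0)
    show "source p" if "G (c2 + 1) p \<noteq> 0" for p
    proof -
      have "G (Suc c2) p \<noteq> 0" using that by simp
      then show ?thesis using Zsupp[of c2 p] Zsupp[of c1 p] Zsupp[of c1 "p + int c2 - int c1"] le nonneg
        unfolding G2'[OF le(3)] source_def Let_def by (auto split: if_splits simp: of_nat_diff)
    qed
    have bound: "- int c2 - 2 < p \<and> p < a1 + 1" if "G r p \<noteq> 0" "r \<le> c2 + 1" for r p
    proof -
      have "r \<noteq> 0"
      proof
        assume "r = 0"
        then show False using that(1) G0[of p] by simp
      qed
      then obtain k where k: "r = Suc k" by (cases r) simp_all
      show ?thesis
      proof (cases "k \<le> c1")
        case True
        then show ?thesis using that G1[OF True] Zsupp[of k p] le unfolding k by auto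
      next
        case False
        then show ?thesis using that G2[of k p] Zsupp[of k p] Zsupp[of c1 p] Zsupp[of c1 "p + int k - int c1"] le
          unfolding k by (auto split: if_splits)
      qed
    qed
    then show "- int c2 - 2 < p" "p < a1 + 1" if "G r p \<noteq> 0" "r \<le> c2 + 1" for r p
      using that by auto
    show "\<exists>r\<le>c2 + 1. \<exists>p. G r p \<noteq> 0" if "f i j l \<noteq> 0" for i j l
    proof -
      have r: "region i j l" "i + j + l = D" using supp[OF that] by auto
      define k where "k = nat l"
      have "l = int k" "j = D - int k - i" using r unfolding region_def k_def by auto
      then have Z: "Z k i \<noteq> 0" using that unfolding Z_def by simp
      then have "k \<le> c2" using Zsupp[OF Z] le by auto
      moreover have "G (Suc k) i \<noteq> 0"
        using Z Zsupp[OF Z] G1[of k i] G2[of k i] by (cases "k \<le> c1") (auto split: if_splits)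
      ultimately show ?thesis by (intro exI[of _ "Suc k"]) auto
    qed
    fix r p assume "r < c2 + 1"
    then have r: "r \<le> c2" by simp
    show "G r p = (if stay (Suc r) p then G (Suc r) p else 0) +
                   (if move (Suc r) (p - 1) then G (Suc r) (p - 1) else 0)"
    proof (cases "r \<le> c1")
      case True
      show ?thesis
      proof (cases r)
        case 0
        have "stay (Suc 0) p \<longleftrightarrow> D - p + 1 \<le> b1" "move (Suc 0) (p - 1) \<longleftrightarrow> p \<le> a1"
          using st1[of 0 p] mv1[of 0 "p - 1"] by simp_all
        moreover have "region p (D + 1 - p) 0 \<longleftrightarrow> 0 \<le> p \<and> p \<le> a1 \<and> 0 \<le> D + 1 - p \<and> D + 1 - p \<le> b1"
          using le unfolding region_def by auto
        moreover have "G 0 p = 0" "G (Suc 0) p = Z 0 p" "G (Suc 0) (p - 1) = Z 0 (p - 1)"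
          using G1[of 0] unfolding G_def by auto
        ultimately show ?thesis unfolding 0
          using Zflow0[of p] Zsupp[of 0 p] Zsupp[of 0 "p - 1"] le
          by (smt (verit) add_0 add_0_right of_nat_0)
      next
        case (Suc k)
        have "region p (D - int k - p) (int k + 1) \<longleftrightarrow> 0 \<le> p \<and> p \<le> a1 \<and> 0 \<le> D - int k - p \<and> D - int k - p \<le> b1"
          using le True Suc unfolding region_def by auto
        moreover have "G (Suc k) p = Z k p" "G (Suc (Suc k)) p = Z (Suc k) p" "G (Suc (Suc k)) (p - 1) = Z (Suc k) (p - 1)"
          using G1 True Suc by auto
        moreover have "stay (Suc (Suc k)) p \<longleftrightarrow> D - int k - p \<le> b1" "move (Suc (Suc k)) (p - 1) \<longleftrightarrow> p \<le> a1"
          using st1[of "Suc k" p] mv1[of "Suc k" "p - 1"] True Suc by (simp_all add: algebra_simps)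
        ultimately show ?thesis unfolding Suc
          using Zflow[of p k] Zsupp[of k p] Zsupp[of "Suc k" p] Zsupp[of "Suc k" "p - 1"] le
          by (smt (verit) add_0 add_0_right of_nat_Suc)
      qed
    next
      case False
      then obtain k where k: "r = Suc k" "c1 \<le> k" by (cases r) auto
      let ?y = "D - int k - p"
      have st: "stay (Suc r) p \<longleftrightarrow> ?y - 1 \<le> b2 \<and> (p > a2 \<or> ?y \<le> b2)"
        and mv: "move (Suc r) (p - 1) \<longleftrightarrow> ?y > b2 \<or> p \<le> a2"
        using st2[of r p] mv2[of r "p - 1"] False k by auto
      have Gp: "G (Suc r) p = (if ?y - 1 > b2 then Z c1 (p + int k + 1 - int c1)
          else if p > a2 then (if D - int c1 - p \<le> b2 then Z c1 p else 0) else Z r p)"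
        using G2[of r p] False k by (simp add: algebra_simps)
      have Gp1: "G (Suc r) (p - 1) = (if ?y > b2 then Z c1 (p + int k - int c1)
          else if p - 1 > a2 then (if D - int c1 - (p - 1) \<le> b2 then Z c1 (p - 1) else 0) else Z r (p - 1))"
        using G2[of r "p - 1"] False k by (simp add: algebra_simps)
      have Gr: "G r p = (if ?y > b2 then Z c1 (p + int k - int c1)
          else if p > a2 then (if D - int c1 - p \<le> b2 then Z c1 p else 0) else Z k p)"
        using G2'[OF k(2), of p] k by simp
      consider "?y > b2" | "?y \<le> b2" "p > a2" | "?y \<le> b2" "p \<le> a2" by linarith
      then show ?thesis
      proof cases
        \<comment> \<open>On a left ray the amount arrives by a move. If \<open>?y = b2 + 1\<close>
          and \<open>p > a2\<close>, a stay is allowed too, but its amount is \<open>0\<close> by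
          the guard in \<open>G\<close>.\<close>
        case 1
        then show ?thesis using k unfolding Gr Gp Gp1 st mv by auto
      next
        case 2
        then show ?thesis unfolding Gr Gp Gp1 st mv by auto
      next
        case 3
        \<comment> \<open>Inside the small box this is the kernel equation; at points with a
          negative exponent all three values vanish.\<close>
        have "Z k p = Z r p + Z r (p - 1)"
        proof (cases "0 \<le> p \<and> 0 \<le> ?y")
          case True
          then have "region p ?y (int k + 1)" using 3 r k unfolding region_def by auto
          then show ?thesis using Zflow k by simp
        next
          case False
          then show ?thesis using Zsupp[of k p] Zsupp[of r p] Zsupp[of r "p - 1"] k by force
        qed
        then show ?thesis using 3 unfolding Gr Gp Gp1 st mv by auto
      qed
    qed
  qed
qed

text \<open>Dual to the flow: the sums \<open>E\<close> of target values weighted by path counts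
  obey the recursion of the signed layers of \<open>g\<close> and agree with them inside the boxes.
  Layer \<open>c1 + 1\<close> vanishes outside the small box, and these zeros are transported along
  the rays; layer \<open>c2 + 1\<close> vanishes everywhere. Hence the sums vanish at all
  sources.\<close>

lemma cokernel_paths:
  fixes g :: "int \<Rightarrow> int \<Rightarrow> int \<Rightarrow> 'k::comm_ring_1"
  assumes supp: "\<And>i j l. g i j l \<noteq> 0 \<Longrightarrow> region i j l \<and> i + j + l = D + 1"
    and ker: "\<And>i j l. region i j l \<Longrightarrow> i + j + l = D \<Longrightarrow> g (i + 1) j l + g i (j + 1) l + g i j (l + 1) = 0"
    and "source p"
  shows "(\<Sum>t\<in>Collect target. paths (c2 + 1) p t * g t (D + 1 - t) 0) = 0"
proof -
  \<comment> \<open>The sign makes each layer the sum of two neighbouring values of the layer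
    below.\<close>
  define Y where "Y k p = (-1) ^ k * g p (D + 1 - int k - p) (int k)" for k :: nat and p
  define E where "E r p = (\<Sum>t\<in>Collect target. paths r p t * Y 0 t)" for r p
  have fin: "finite (Collect target)"
    by (rule finite_subset[of _ "{max 0 (D + 1 - b1)..min a1 (D + 1)}"]) (auto simp: target_def)
  have Ysupp: "0 \<le> p \<and> 0 \<le> D + 1 - int k - p \<and> ((p \<le> a1 \<and> D + 1 - int k - p \<le> b1 \<and> k \<le> c1) \<or> (p \<le> a2 \<and> D + 1 - int k - p \<le> b2 \<and> k \<le> c2))"
    if "Y k p \<noteq> 0" for k p
  proof -
    have "g p (D + 1 - int k - p) (int k) \<noteq> 0" using that unfolding Y_def by auto
    from supp[OF this] show ?thesis unfolding region_def by auto
  qed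
  have Yrec: "Y (Suc k) p = Y k p + Y k (p + 1)" if "region p (D - int k - p) (int k)" for k p
  proof -
    have "g (p + 1) (D - int k - p) (int k) + g p (D - int k - p + 1) (int k) + g p (D - int k - p) (int k + 1) = 0"
      using ker[OF that] by simp
    then have eq: "g p (D - int k - p) (int k + 1) = - (g (p + 1) (D - int k - p) (int k) + g p (D - int k - p + 1) (int k))"
      by (simp only: add_eq_0_iff)
    have "Y (Suc k) p = (-1) ^ Suc k * g p (D - int k - p) (int k + 1)"
      "Y k p = (-1) ^ k * g p (D - int k - p + 1) (int k)"
      "Y k (p + 1) = (-1) ^ k * g (p + 1) (D - int k - p) (int k)"
      unfolding Y_def by (simp_all add: algebra_simps)
    then show ?thesis unfolding eq by (simp only: power_Suc distrib_left) (simp add: algebra_simps)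
  qed
  have Erec: "E (Suc k) p = (if stay (Suc k) p then E k p else 0) + (if move (Suc k) p then E k (p + 1) else 0)" for k p
    unfolding E_def by (simp add: sum.distrib distrib_right if_distrib[of "\<lambda>x. x * _"] cong: if_cong)
  have E1: "E k p = Y k p" if "k \<le> c1 + 1" "0 \<le> p" "p \<le> a1" "0 \<le> D + 1 - int k - p" "D + 1 - int k - p \<le> b1" for k p
    using that
  proof (induction k arbitrary: p)
    case 0
    then have "target p" unfolding target_def by auto
    have "E 0 p = (\<Sum>t\<in>Collect target. if t = p then Y 0 p else 0)" unfolding E_def by (rule sum.cong) auto
    then show ?case using \<open>target p\<close> fin by simp
  next
    case (Suc k)
    then have st: "stay (Suc k) p \<longleftrightarrow> D - int k - p + 1 \<le> b1" and mv: "move (Suc k) p \<longleftrightarrow> p + 1 \<le> a1"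
      unfolding stay_def move_def Let_def by auto
    have "region p (D - int k - p) (int k)" using Suc.prems unfolding region_def by auto
    then have "Y (Suc k) p = Y k p + Y k (p + 1)" by (rule Yrec)
    \<comment> \<open>A step that would leave the box meets a vanishing value of \<open>Y\<close>,
      so the conditions in the recursion of \<open>E\<close> match the support of
      \<open>Y\<close>.\<close>
    moreover have "Y k p = (if stay (Suc k) p then E k p else 0)"
      using Suc.IH[of p] Suc.prems Ysupp[of k p] le unfolding st by (cases "Y k p = 0") auto
    moreover have "Y k (p + 1) = (if move (Suc k) p then E k (p + 1) else 0)"
      using Suc.IH[of "p + 1"] Suc.prems Ysupp[of k "p + 1"] le unfolding mv by (cases "Y k (p + 1) = 0") auto
    ultimately show ?case unfolding Erec by simp
  qed
  \<comment> \<open>The three parts follow the small box, a left ray, along which the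
    \<open>y\<close>-exponent is constant, and a right ray, along which \<open>p\<close> is
    constant.\<close>
  have E2: "(0 \<le> p \<and> p \<le> a2 \<and> 0 \<le> D - int k - p \<and> D - int k - p \<le> b2 \<longrightarrow> E (Suc k) p = Y (Suc k) p) \<and>
     (0 \<le> p + int k - int c1 \<and> p + int k - int c1 \<le> a1 \<and> b2 < D - int k - p \<and> D - int k - p \<le> b1 \<longrightarrow> E (Suc k) p = 0) \<and>
     (0 \<le> p \<and> p \<le> a1 \<and> a2 < p \<and> D - int c1 - p \<le> b2 \<and> 0 \<le> D - int c1 - p \<longrightarrow> E (Suc k) p = 0)"
    if "c1 \<le> k" "k \<le> c2" for k p
    using that
  proof (induction k arbitrary: p rule: dec_induct)
    case base
    have "Y (Suc c1) p = 0" if "a2 < p \<or> b2 < D - int c1 - p"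
      using Ysupp[of "Suc c1" p] that by (cases "Y (Suc c1) p = 0") auto
    then show ?case using E1[of "Suc c1" p] le nonneg by auto
  next
    case (step k)
    then have st: "stay (Suc (Suc k)) p \<longleftrightarrow> D - int k - p - 1 \<le> b2 \<and> (p > a2 \<or> D - int k - p \<le> b2)"
      and mv: "move (Suc (Suc k)) p \<longleftrightarrow> D - int k - p - 1 > b2 \<or> p + 1 \<le> a2"
      unfolding stay_def move_def Let_def by auto
    have IH1: "0 \<le> p \<Longrightarrow> p \<le> a2 \<Longrightarrow> 0 \<le> D - int k - p \<Longrightarrow> D - int k - p \<le> b2 \<Longrightarrow> E (Suc k) p = Y (Suc k) p" 
      and IH2: "0 \<le> p + int k - int c1 \<Longrightarrow> p + int k - int c1 \<le> a1 \<Longrightarrow> b2 < D - int k - p \<Longrightarrow> D - int k - p \<le> b1 \<Longrightarrow> E (Suc k) p = 0"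
      and IH3: "0 \<le> p \<Longrightarrow> p \<le> a1 \<Longrightarrow> a2 < p \<Longrightarrow> D - int c1 - p \<le> b2 \<Longrightarrow> 0 \<le> D - int c1 - p \<Longrightarrow> E (Suc k) p = 0"
      for p using step.IH[of p] step.prems by auto
    have A: "E (Suc (Suc k)) p = Y (Suc (Suc k)) p" if "0 \<le> p" "p \<le> a2" "0 \<le> D - int k - p - 1" "D - int k - p - 1 \<le> b2"
    proof -
      have "region p (D - int (Suc k) - p) (int (Suc k))" using that step.prems unfolding region_def by auto
      then have "Y (Suc (Suc k)) p = Y (Suc k) p + Y (Suc k) (p + 1)" by (rule Yrec)
      moreover have "Y (Suc k) p = (if stay (Suc (Suc k)) p then E (Suc k) p else 0)"
        using IH1[of p] that Ysupp[of "Suc k" p] step.hyps unfolding st by (cases "Y (Suc k) p = 0") auto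
      moreover have "Y (Suc k) (p + 1) = (if move (Suc (Suc k)) p then E (Suc k) (p + 1) else 0)"
        using IH1[of "p + 1"] that Ysupp[of "Suc k" "p + 1"] step.hyps unfolding mv by (cases "Y (Suc k) (p + 1) = 0") auto
      ultimately show ?thesis unfolding Erec[of "Suc k"] by simp
    qed
    have B: "E (Suc (Suc k)) p = 0" if "0 \<le> p + int k + 1 - int c1" "p + int k + 1 - int c1 \<le> a1" "b2 < D - int k - p - 1" "D - int k - p - 1 \<le> b1"
      using IH2[of "p + 1"] that st mv unfolding Erec[of "Suc k"] by (simp add: algebra_simps)
    have C: "E (Suc (Suc k)) p = 0" if "0 \<le> p" "p \<le> a1" "a2 < p" "D - int c1 - p \<le> b2" "0 \<le> D - int c1 - p"
      using IH3[of p] that st mv step.hyps unfolding Erec[of "Suc k"] by simp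
    show ?case using A B C by (auto simp: algebra_simps)
  qed
  have "E (Suc c2) p = 0"
  proof -
    have "Y (Suc c2) p = 0" using Ysupp[of "Suc c2" p] le by (cases "Y (Suc c2) p = 0") auto
    then show ?thesis using E2[OF le(3) order.refl, of p] \<open>source p\<close> le(3) unfolding source_def Let_def
      by (auto simp: of_nat_diff)
  qed
  then show ?thesis unfolding E_def Y_def by simp
qed

text \<open>The first alternative is injectivity of multiplication by \<open>x + y + z\<close> in
  degree \<open>D\<close>, the second is injectivity of its transpose. A family using all targets
  gives the second, one using all sources gives the first.\<close>

lemma maximal_rank:
  shows "(\<forall>f :: int \<Rightarrow> int \<Rightarrow> int \<Rightarrow> 'k::field_char_0. (\<forall>i j l. f i j l \<noteq> 0 \<longrightarrow> region i j l \<and> i + j + l = D) \<longrightarrow>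
            (\<forall>i j l. region i j l \<longrightarrow> i + j + l = D + 1 \<longrightarrow> f (i - 1) j l + f i (j - 1) l + f i j (l - 1) = 0) \<longrightarrow>
            (\<forall>i j l. f i j l = 0)) \<or>
         (\<forall>g :: int \<Rightarrow> int \<Rightarrow> int \<Rightarrow> 'k. (\<forall>i j l. g i j l \<noteq> 0 \<longrightarrow> region i j l \<and> i + j + l = D + 1) \<longrightarrow>
            (\<forall>i j l. region i j l \<longrightarrow> i + j + l = D \<longrightarrow> g (i + 1) j l + g i (j + 1) l + g i j (l + 1) = 0) \<longrightarrow>
            (\<forall>i j l. g i j l = 0))"
proof -
  obtain d \<sigma> t where fam: "increasing d \<sigma>" "increasing d t" "disjoint_paths stay move d t (c2 + 1) \<sigma>"
    and tgt: "\<And>i. i < d \<Longrightarrow> target (t i)" and src: "\<And>i. i < d \<Longrightarrow> source (\<sigma> i)"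
    and cover: "(\<forall>p. target p \<longrightarrow> (\<exists>i<d. t i = p)) \<or> (\<forall>p. source p \<longrightarrow> (\<exists>i<d. \<sigma> i = p))"
    using path_family by blast
  have inj: "inj_on p {..<d}" if "increasing d p" for p
    using that unfolding increasing_def inj_on_def by (metis lessThan_iff less_irrefl linorder_neqE_nat)
  from cover show ?thesis
  proof
    assume cov: "\<forall>p. target p \<longrightarrow> (\<exists>i<d. t i = p)"
    have im: "t ` {..<d} = Collect target"
    proof (intro equalityI subsetI)
      fix p assume "p \<in> Collect target"
      then show "p \<in> t ` {..<d}" using cov by blast
    next
      fix p assume "p \<in> t ` {..<d}"
      then obtain i where "i < d" "p = t i" by blast
      then show "p \<in> Collect target" using tgt[of i] by simp
    qed
    have "g i j l = 0" if g: "\<And>i j l. g i j l \<noteq> 0 \<Longrightarrow> region i j l \<and> i + j + l = D + 1"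
      and ker: "\<And>i j l. region i j l \<Longrightarrow> i + j + l = D \<Longrightarrow> g (i + 1) j l + g i (j + 1) l + g i j (l + 1) = 0"
    for g :: "int \<Rightarrow> int \<Rightarrow> int \<Rightarrow> 'k" and i j l
    proof -
      \<comment> \<open>The chosen sources yield as many equations as there are targets, with an
        invertible matrix, so layer \<open>0\<close> of \<open>g\<close> vanishes.\<close>
      have z: "g (t k) (D + 1 - t k) 0 = 0" if "k < d" for k
      proof (rule path_matrix_right_kernel[OF fam(2,1,3) _ that])
        fix i assume "i < d"
        have "(\<Sum>x\<in>Collect target. paths (c2 + 1) (\<sigma> i) x * g x (D + 1 - x) 0) = 0"
        proof (rule cokernel_paths)
          show "region i j l \<and> i + j + l = D + 1" if "g i j l \<noteq> 0" for i j l using g[OF that] .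
          show "g (i + 1) j l + g i (j + 1) l + g i j (l + 1) = 0" if "region i j l" "i + j + l = D" for i j l
            using ker[OF that] .
          show "source (\<sigma> i)" by (rule src) fact
        qed
        then show "(\<Sum>k<d. paths (c2 + 1) (\<sigma> i) (t k) * g (t k) (D + 1 - t k) 0) = 0"
          unfolding im[symmetric] by (simp add: sum.reindex[OF inj[OF fam(2)]])
      qed
      \<comment> \<open>Each layer is minus a sum of two shifts of the layer below, so zero
        propagates upwards in \<open>z\<close>.\<close>
      have "g i j (int k) = 0" for i j k
      proof (induction k arbitrary: i j)
        case 0
        show ?case
        proof (rule ccontr)
          assume "g i j (int 0) \<noteq> 0"
          then have "region i j 0" "j = D + 1 - i" "g i j 0 \<noteq> 0" using g[of i j 0] by auto
          then have "target i" using le unfolding region_def target_def by auto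
          then show False using cov z \<open>g i j 0 \<noteq> 0\<close> \<open>j = D + 1 - i\<close> by blast
        qed
      next
        case (Suc k)
        show ?case
        proof (rule ccontr)
          assume *: "g i j (int (Suc k)) \<noteq> 0"
          then have "region i j (int (Suc k))" "i + j + int (Suc k) = D + 1" using g by auto
          then have "region i j (int k)" "i + j + int k = D" unfolding region_def by auto
          from ker[OF this] have "g i j (int k + 1) = 0" using Suc by simp
          then show False using * by (simp add: add.commute)
        qed
      qed
      from this[of i j "nat l"] show ?thesis using g[of i j l] unfolding region_def by (cases "g i j l = 0") auto
    qed
    then show ?thesis by blast
  next
    assume cov: "\<forall>p. source p \<longrightarrow> (\<exists>i<d. \<sigma> i = p)"
    have "f i j l = 0" if f: "\<forall>i j l. f i j l \<noteq> 0 \<longrightarrow> region i j l \<and> i + j + l = D"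
      and ker: "\<forall>i j l. region i j l \<longrightarrow> i + j + l = D + 1 \<longrightarrow> f (i - 1) j l + f i (j - 1) l + f i j (l - 1) = 0"
    for f :: "int \<Rightarrow> int \<Rightarrow> int \<Rightarrow> 'k" and i j l
    proof (rule ccontr)
      assume nz: "f i j l \<noteq> 0"
      obtain G :: "nat \<Rightarrow> int \<Rightarrow> 'k" where flow: "(\<forall>p. G 0 p = 0) \<and> (\<forall>p. G (c2 + 1) p \<noteq> 0 \<longrightarrow> source p) \<and>
        (\<forall>r p. G r p \<noteq> 0 \<longrightarrow> r \<le> c2 + 1 \<longrightarrow> - int c2 - 2 < p \<and> p < a1 + 1) \<and>
        (\<forall>i j l. f i j l \<noteq> 0 \<longrightarrow> (\<exists>r\<le>c2 + 1. \<exists>p. G r p \<noteq> 0)) \<and>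
        (\<forall>r p. r < c2 + 1 \<longrightarrow> G r p = (if stay (Suc r) p then G (Suc r) p else 0) +
                   (if move (Suc r) (p - 1) then G (Suc r) (p - 1) else 0))"
        using kernel_flow[OF f ker] by (elim exE) (rule that)
      have G0: "\<And>p. G 0 p = 0" and Gs: "\<And>p. G (c2 + 1) p \<noteq> 0 \<Longrightarrow> source p"
        and Gb: "\<And>r p. G r p \<noteq> 0 \<Longrightarrow> r \<le> c2 + 1 \<Longrightarrow> - int c2 - 2 < p \<and> p < a1 + 1"
        and Gn: "\<And>i j l. f i j l \<noteq> 0 \<Longrightarrow> \<exists>r\<le>c2 + 1. \<exists>p. G r p \<noteq> 0"
        and Gf: "\<And>r p. r < c2 + 1 \<Longrightarrow> G r p = (if stay (Suc r) p then G (Suc r) p else 0) +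
                   (if move (Suc r) (p - 1) then G (Suc r) (p - 1) else 0)"
        using flow by blast+
      \<comment> \<open>Cutting off above \<open>c2 + 1\<close> gives bounded support for all
        \<open>r\<close>, as the pairing requires.\<close>
      define G' where "G' r p = (if r \<le> c2 + 1 then G r p else 0)" for r p
      let ?I = "{- int c2 - 2..a1 + 1}"
      have pair: "(\<Sum>p\<in>?I. G' (c2 + 1) p * paths (c2 + 1) p x) = G' 0 x" for x
        using Gb Gf by (intro path_count_pairing[where R = "c2 + 1"]) (auto simp: G'_def split: if_splits)
      \<comment> \<open>The flow starts on sources only, all of which are listed by
        \<open>\<sigma>\<close>, and ends with \<open>0\<close>; its starting amounts therefore form
        a left kernel vector.\<close>
      have "(\<Sum>i<d. G (c2 + 1) (\<sigma> i) * paths (c2 + 1) (\<sigma> i) x) = 0" for x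
      proof -
        have "(\<Sum>i<d. G (c2 + 1) (\<sigma> i) * paths (c2 + 1) (\<sigma> i) x) =
            (\<Sum>p\<in>\<sigma> ` {..<d}. G (c2 + 1) p * paths (c2 + 1) p x)"
          by (simp add: sum.reindex[OF inj[OF fam(1)]])
        also have "\<dots> = (\<Sum>p\<in>?I. G (c2 + 1) p * paths (c2 + 1) p x)"
        proof (rule sum.mono_neutral_cong)
          show "G (c2 + 1) p * paths (c2 + 1) p x = 0" if "p \<in> \<sigma> ` {..<d} - ?I" for p
            using Gb[of "c2 + 1" p] that by force
          show "G (c2 + 1) p * paths (c2 + 1) p x = 0" if "p \<in> ?I - \<sigma> ` {..<d}" for p
            using Gs[of p] cov that by force
        qed auto
        finally show ?thesis using pair[of x] G0 unfolding G'_def by simp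
      qed
      then have "G (c2 + 1) (\<sigma> i) = 0" if "i < d" for i
        using path_matrix_left_kernel[OF fam(2,1,3), of "\<lambda>i. G (c2 + 1) (\<sigma> i)"] that by blast
      then have "G (c2 + 1) p = 0" for p using Gs[of p] cov by blast
      \<comment> \<open>The starting amounts determine all later ones by the flow equation.\<close>
      then have "G (c2 + 1 - s) p = 0" for s p
      proof (induction s arbitrary: p)
        case (Suc s)
        show ?case
        proof (cases "s < c2 + 1")
          case True
          then have "Suc (c2 + 1 - Suc s) = c2 + 1 - s" "c2 + 1 - Suc s < c2 + 1" by auto
          then show ?thesis using Gf[of "c2 + 1 - Suc s" p] Suc.IH[OF Suc.prems] by simp
        next
          case False
          then show ?thesis using Suc by simp
        qed
      qed auto
      moreover obtain r p where "r \<le> c2 + 1" "G r p \<noteq> 0" using Gn[OF nz] by blast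
      ultimately show False by (metis diff_diff_cancel)
    qed
    then show ?thesis by blast
  qed
qed

end

section \<open>Quotients by monomial ideals\<close>

lemma PolyR_simps [simp]:
  "carrier PolyR = UNIV" "p \<otimes>\<^bsub>PolyR\<^esub> q = p * q" "p \<oplus>\<^bsub>PolyR\<^esub> q = p + q"
  "\<zero>\<^bsub>PolyR\<^esub> = 0" "\<one>\<^bsub>PolyR\<^esub> = 1"
  unfolding PolyR_def ring_of_type_algebra_def by simp_all

lemma cring_PolyR: "cring PolyR"
  unfolding PolyR_def by (rule cring_from_type_algebra)

lemma ring_PolyR: "ring PolyR"
  unfolding PolyR_def by (rule ring_from_type_algebra)

lemma a_inv_PolyR [simp]: "\<ominus>\<^bsub>PolyR\<^esub> p = - p"
proof -
  interpret ring PolyR by (rule ring_PolyR)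
  show ?thesis by (rule minus_equality) auto
qed

lemma a_minus_PolyR [simp]: "p \<ominus>\<^bsub>PolyR\<^esub> q = p - q"
  unfolding a_minus_def by simp

section \<open>Coefficients of products with monomials\<close>

lemma poly_mapping_sum_single:
  "(\<Sum>m\<in>Poly_Mapping.keys p. Poly_Mapping.single m (Poly_Mapping.lookup p m)) = p"
proof (rule poly_mapping_eqI)
  fix u
  have "Poly_Mapping.lookup (\<Sum>m\<in>Poly_Mapping.keys p. Poly_Mapping.single m (Poly_Mapping.lookup p m)) u =
      (\<Sum>m\<in>Poly_Mapping.keys p. if m = u then Poly_Mapping.lookup p u else 0)"
    unfolding lookup_sum by (rule sum.cong) (auto simp: lookup_single when_def)
  also have "\<dots> = Poly_Mapping.lookup p u" by (auto simp: in_keys_iff)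
  finally show "Poly_Mapping.lookup (\<Sum>m\<in>Poly_Mapping.keys p. Poly_Mapping.single m (Poly_Mapping.lookup p m)) u = Poly_Mapping.lookup p u" .
qed

lemma lookup_single_mult_sum:
  fixes p :: "('v, 'k::comm_ring_1) mvpoly"
  shows "Poly_Mapping.lookup (Poly_Mapping.single m c * p) u =
    (\<Sum>w\<in>Poly_Mapping.keys p. if m + w = u then c * Poly_Mapping.lookup p w else 0)"
proof -
  have "Poly_Mapping.single m c * p =
      (\<Sum>w\<in>Poly_Mapping.keys p. Poly_Mapping.single (m + w) (c * Poly_Mapping.lookup p w))"
    by (subst poly_mapping_sum_single[of p, symmetric]) (simp add: sum_distrib_left mult_single)
  then show ?thesis by (simp add: lookup_sum lookup_single when_def)
qed

lemma lookup_single_mult: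
  fixes p :: "('v, 'k::comm_ring_1) mvpoly"
  shows "Poly_Mapping.lookup (Poly_Mapping.single m c * p) (m + w) = c * Poly_Mapping.lookup p w"
proof -
  have "Poly_Mapping.lookup (Poly_Mapping.single m c * p) (m + w) =
      (\<Sum>x\<in>Poly_Mapping.keys p. if x = w then c * Poly_Mapping.lookup p w else 0)"
    unfolding lookup_single_mult_sum by (rule sum.cong) auto
  then show ?thesis by (auto simp: in_keys_iff)
qed

lemma lookup_single_mult_eq_0:
  fixes p :: "('v, 'k::comm_ring_1) mvpoly"
  assumes "\<And>w. m + w \<noteq> u"
  shows "Poly_Mapping.lookup (Poly_Mapping.single m c * p) u = 0"
  unfolding lookup_single_mult_sum using assms by simp

lemma ideal_of_exponent_set:
  fixes E :: "('v \<Rightarrow>\<^sub>0 nat) set"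
  assumes "\<And>m n. m \<in> E \<Longrightarrow> n + m \<in> E"
  shows "ideal {p :: ('v, 'k::comm_ring_1) mvpoly. Poly_Mapping.keys p \<subseteq> E} PolyR"
proof (rule idealI[OF ring_PolyR])
  show "subgroup {p :: ('v, 'k) mvpoly. Poly_Mapping.keys p \<subseteq> E} (add_monoid PolyR)"
  proof
    fix p q :: "('v, 'k) mvpoly"
    assume "p \<in> {p. Poly_Mapping.keys p \<subseteq> E}" "q \<in> {p. Poly_Mapping.keys p \<subseteq> E}"
    then show "p \<otimes>\<^bsub>add_monoid PolyR\<^esub> q \<in> {p. Poly_Mapping.keys p \<subseteq> E}"
      using keys_add[of p q] by auto
  next
    fix p :: "('v, 'k) mvpoly"
    assume "p \<in> {p. Poly_Mapping.keys p \<subseteq> E}"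
    then show "inv\<^bsub>add_monoid PolyR\<^esub> p \<in> {p. Poly_Mapping.keys p \<subseteq> E}"
      using a_inv_PolyR[of p] unfolding a_inv_def by (simp add: keys_def)
  qed auto
next
  fix p q :: "('v, 'k) mvpoly"
  assume p: "p \<in> {p. Poly_Mapping.keys p \<subseteq> E}"
  have "Poly_Mapping.keys (q * p) \<subseteq> E" using keys_mult[of q p] p assms by blast
  then show "q \<otimes>\<^bsub>PolyR\<^esub> p \<in> {p. Poly_Mapping.keys p \<subseteq> E}" "p \<otimes>\<^bsub>PolyR\<^esub> q \<in> {p. Poly_Mapping.keys p \<subseteq> E}"
    by (simp_all add: mult.commute)
qed

text \<open>The exponents above some generator form an up-closed set \<open>E\<close>. Polynomials
  supported on \<open>E\<close> form an ideal, and each is a sum of multiples of generators; so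
  membership in \<open>I\<close> is tested on each monomial separately.\<close>

lemma monomial_ideal_exponents:
  fixes I :: "('v, 'k::comm_ring_1) mvpoly set"
  assumes "monomial_ideal I"
  obtains E where "\<And>m n. m \<in> E \<Longrightarrow> n + m \<in> E" "I = {p. Poly_Mapping.keys p \<subseteq> E}"
proof -
  obtain M where I: "I = Idl\<^bsub>PolyR\<^esub> (monom ` M)" using assms unfolding monomial_ideal_def by blast
  define E where "E = {n + m | n m. m \<in> M}"
  have up: "n + m \<in> E" if "m \<in> E" for m n
  proof -
    obtain n' m' where "m = n' + m'" "m' \<in> M" using \<open>m \<in> E\<close> unfolding E_def by blast
    then have "n + m = (n + n') + m'" by (simp add: add.assoc)
    then show ?thesis using \<open>m' \<in> M\<close> unfolding E_def by blast
  qed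
  have "monom m \<in> {p :: ('v, 'k) mvpoly. Poly_Mapping.keys p \<subseteq> E}" if "m \<in> M" for m
  proof -
    have "0 + m \<in> E" using that unfolding E_def by blast
    then show ?thesis unfolding monom_def by simp
  qed
  then have "I \<subseteq> {p. Poly_Mapping.keys p \<subseteq> E}"
    unfolding I genideal_def using ideal_of_exponent_set[OF up, where 'k = 'k] by blast
  moreover have "p \<in> J" if J: "ideal J PolyR" "monom ` M \<subseteq> J" and p: "Poly_Mapping.keys p \<subseteq> E"
    for J and p :: "('v, 'k) mvpoly"
  proof -
    interpret J: ideal J PolyR by (rule J)
    have single: "Poly_Mapping.single m c \<in> J" if "m \<in> E" for m c
    proof -
      obtain n m' where m: "m = n + m'" "m' \<in> M" using \<open>m \<in> E\<close> unfolding E_def by blast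
      then have "Poly_Mapping.single n c * monom m' \<in> J"
        using J.I_l_closed[of "monom m'" "Poly_Mapping.single n c"] J(2) by auto
      then show ?thesis unfolding monom_def m mult_single by simp
    qed
    have sum: "sum f S \<in> J" if "\<And>x. x \<in> S \<Longrightarrow> f x \<in> J" for f and S :: "('v \<Rightarrow>\<^sub>0 nat) set"
      using that
    proof (induction S rule: infinite_finite_induct)
      case (insert x S)
      then have "f x \<in> J" "sum f S \<in> J" by auto
      then show ?case using additive_subgroup.a_closed[OF J.is_additive_subgroup, of "f x" "sum f S"] insert.hyps
        by simp
    qed (use additive_subgroup.zero_closed[OF J.is_additive_subgroup] in auto)
    have "(\<Sum>m\<in>Poly_Mapping.keys p. Poly_Mapping.single m (Poly_Mapping.lookup p m)) \<in> J"
      using p by (intro sum single) auto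
    then show ?thesis by (simp add: poly_mapping_sum_single)
  qed
  then have "{p. Poly_Mapping.keys p \<subseteq> E} \<subseteq> I" unfolding I genideal_def by auto
  ultimately have "I = {p. Poly_Mapping.keys p \<subseteq> E}" by (rule equalityI)
  with up show ?thesis by (rule that)
qed

locale monomial_quotient =
  fixes E :: "('v \<Rightarrow>\<^sub>0 nat) set" and I :: "('v, 'k::field) mvpoly set"
  assumes up: "m \<in> E \<Longrightarrow> n + m \<in> E"
    and I_eq: "I = {p. Poly_Mapping.keys p \<subseteq> E}"
begin

section \<open>Residue classes modulo a monomial ideal\<close>

lemma ideal_I: "ideal I PolyR"
  unfolding I_eq by (rule ideal_of_exponent_set) (rule up)

sublocale Q: cring "quot I"
  by (rule ideal.quotient_is_cring[OF ideal_I cring_PolyR])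

sublocale I: ideal I PolyR by (rule ideal_I)

lemma hom_cls: "ring_hom_ring PolyR (quot I) (cls I)"
  unfolding cls_def by (rule I.rcos_ring_hom_ring)

lemma cls_eq_iff: "cls I p = cls I q \<longleftrightarrow> p - q \<in> I"
  using I.quotient_eq_iff_same_a_r_cos[OF ideal_I, of p q] unfolding cls_def by simp

lemma cls_mult: "cls I p \<otimes>\<^bsub>quot I\<^esub> cls I q = cls I (p * q)"
  using ring_hom_mult[OF ring_hom_ring.homh[OF hom_cls], of p q] by simp

lemma cls_add: "cls I p \<oplus>\<^bsub>quot I\<^esub> cls I q = cls I (p + q)"
  using ring_hom_add[OF ring_hom_ring.homh[OF hom_cls], of p q] by simp

lemma cls_one: "\<one>\<^bsub>quot I\<^esub> = cls I 1"
  using ring_hom_one[OF ring_hom_ring.homh[OF hom_cls]] by simp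

lemma cls_zero: "\<zero>\<^bsub>quot I\<^esub> = cls I 0"
  using ring_hom_zero[OF ring_hom_ring.homh[OF hom_cls] ring_PolyR Q.ring_axioms] by simp

lemma cls_eq_zero_iff: "cls I p = \<zero>\<^bsub>quot I\<^esub> \<longleftrightarrow> p \<in> I"
  unfolding cls_zero cls_eq_iff by simp

lemma carrier_quot: "carrier (quot I) = range (cls I)"
  unfolding FactRing_simps cls_def by auto

lemma cls_carrier [simp]: "cls I p \<in> carrier (quot I)"
  unfolding carrier_quot by simp

lemma lookup_eq_0: "p \<in> I \<Longrightarrow> m \<notin> E \<Longrightarrow> Poly_Mapping.lookup p m = 0"
  unfolding I_eq by (auto simp: in_keys_iff subset_iff)

lemma memI: "(\<And>m. m \<notin> E \<Longrightarrow> Poly_Mapping.lookup p m = 0) \<Longrightarrow> p \<in> I"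
  unfolding I_eq by (auto simp: in_keys_iff)

lemma monom_mem_iff: "monom m \<in> I \<longleftrightarrow> m \<in> E"
  unfolding I_eq monom_def by simp

text \<open>The ideals generated by the powers of a variable stabilise, so power \<open>N\<close> is
  a multiple of power \<open>N + 1\<close> modulo \<open>I\<close>. Their difference lies in
  \<open>I\<close> and has coefficient \<open>1\<close> at power \<open>N\<close>, whose exponent is
  therefore in \<open>E\<close>.\<close>

lemma pure_power_exponent:
  assumes "artinian_ring (quot I)"
  shows "\<exists>N. Poly_Mapping.single v N \<in> E"
proof -
  let ?x = "\<lambda>n. cls I (monom (Poly_Mapping.single v n))"
  define J where "J n = PIdl\<^bsub>quot I\<^esub> (?x n)" for n
  have "ideal (J n) (quot I)" for n unfolding J_def by (rule Q.cgenideal_ideal) simp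
  moreover have "J (Suc n) \<subseteq> J n" for n
  proof
    fix a assume "a \<in> J (Suc n)"
    then obtain q where q: "a = cls I q \<otimes>\<^bsub>quot I\<^esub> ?x (Suc n)"
      unfolding J_def cgenideal_def carrier_quot by blast
    have "monom (Poly_Mapping.single v (Suc n)) = monom (Poly_Mapping.single v 1) * (monom (Poly_Mapping.single v n) :: ('v, 'k) mvpoly)"
      unfolding monom_def mult_single by (simp add: single_add[symmetric])
    then have "a = cls I (q * monom (Poly_Mapping.single v 1)) \<otimes>\<^bsub>quot I\<^esub> ?x n"
      unfolding q cls_mult by (simp add: mult.assoc)
    then show "a \<in> J n" unfolding J_def cgenideal_def by (metis (mono_tags, lifting) cls_carrier mem_Collect_eq)
  qed
  ultimately obtain N where N: "\<forall>n\<ge>N. J n = J N"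
    using assms unfolding artinian_ring_def by blast
  have "?x N \<in> J N" unfolding J_def by (rule Q.cgenideal_self) simp
  then have "?x N \<in> J (Suc N)" using N[rule_format, of "Suc N"] by simp
  then obtain q where "?x N = cls I q \<otimes>\<^bsub>quot I\<^esub> ?x (Suc N)"
    unfolding J_def cgenideal_def carrier_quot by blast
  then have mem: "monom (Poly_Mapping.single v N) - q * monom (Poly_Mapping.single v (Suc N)) \<in> I"
    unfolding cls_mult cls_eq_iff .
  have "Poly_Mapping.single v (Suc N) + w \<noteq> Poly_Mapping.single v N" for w :: "'v \<Rightarrow>\<^sub>0 nat"
  proof
    assume "Poly_Mapping.single v (Suc N) + w = Poly_Mapping.single v N"
    from arg_cong[OF this, of "\<lambda>m. Poly_Mapping.lookup m v"] show False by (simp add: lookup_add)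
  qed
  then have "Poly_Mapping.lookup (monom (Poly_Mapping.single v (Suc N)) * q) (Poly_Mapping.single v N) = 0"
    unfolding monom_def by (rule lookup_single_mult_eq_0)
  then have "Poly_Mapping.lookup (monom (Poly_Mapping.single v N) - q * monom (Poly_Mapping.single v (Suc N))) (Poly_Mapping.single v N) = 1"
    by (simp add: lookup_minus mult.commute monom_def)
  then have "Poly_Mapping.single v N \<in> E" using lookup_eq_0[OF mem, of "Poly_Mapping.single v N"] by auto
  then show ?thesis by blast
qed

text \<open>The maximal exponents outside \<open>E\<close> with respect to divisibility.\<close>

definition socle_exponents :: "('v \<Rightarrow>\<^sub>0 nat) set" where
  "socle_exponents = {m. m \<notin> E \<and> (\<forall>v. Poly_Mapping.single v 1 + m \<in> E)}"

text \<open>Lets annihilation by the variables extend to the whole ideal that they generate.\<close>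

lemma annihilator_ideal:
  assumes "a \<in> carrier (quot I)"
  shows "ideal {b \<in> carrier (quot I). b \<otimes>\<^bsub>quot I\<^esub> a = \<zero>\<^bsub>quot I\<^esub>} (quot I)"
proof (rule idealI[OF Q.ring_axioms])
  show "subgroup {b \<in> carrier (quot I). b \<otimes>\<^bsub>quot I\<^esub> a = \<zero>\<^bsub>quot I\<^esub>} (add_monoid (quot I))"
  proof
    fix b assume "b \<in> {b \<in> carrier (quot I). b \<otimes>\<^bsub>quot I\<^esub> a = \<zero>\<^bsub>quot I\<^esub>}"
    then show "inv\<^bsub>add_monoid (quot I)\<^esub> b \<in> {b \<in> carrier (quot I). b \<otimes>\<^bsub>quot I\<^esub> a = \<zero>\<^bsub>quot I\<^esub>}"
      using assms Q.a_inv_closed[of b] Q.l_minus[of b a] Q.minus_zero unfolding a_inv_def by simp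
  qed (use assms in \<open>auto simp: Q.l_distr\<close>)
  fix b x assume b: "b \<in> {b \<in> carrier (quot I). b \<otimes>\<^bsub>quot I\<^esub> a = \<zero>\<^bsub>quot I\<^esub>}" and x: "x \<in> carrier (quot I)"
  show "x \<otimes>\<^bsub>quot I\<^esub> b \<in> {b \<in> carrier (quot I). b \<otimes>\<^bsub>quot I\<^esub> a = \<zero>\<^bsub>quot I\<^esub>}"
    using b x assms by (simp add: Q.m_assoc)
  then show "b \<otimes>\<^bsub>quot I\<^esub> x \<in> {b \<in> carrier (quot I). b \<otimes>\<^bsub>quot I\<^esub> a = \<zero>\<^bsub>quot I\<^esub>}"
    using b x by (simp add: Q.m_comm)
qed

lemma cls_monom_in_socle:
  assumes "m \<in> socle_exponents"
  shows "cls I (monom m) \<in> socle I"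
proof -
  let ?A = "{b \<in> carrier (quot I). b \<otimes>\<^bsub>quot I\<^esub> cls I (monom m) = \<zero>\<^bsub>quot I\<^esub>}"
  have "cls I (var v) \<in> ?A" for v
  proof -
    have "var v * monom m = (monom (Poly_Mapping.single v 1 + m) :: ('v, 'k) mvpoly)"
      unfolding var_def monom_def mult_single by simp
    then show ?thesis using assms unfolding socle_exponents_def
      by (simp add: cls_mult cls_eq_zero_iff monom_mem_iff)
  qed
  then have "hom_max_ideal I \<subseteq> ?A"
    unfolding hom_max_ideal_def genideal_def using annihilator_ideal[OF cls_carrier]
    by (intro Inter_lower) auto
  then show ?thesis unfolding socle_def by auto
qed

text \<open>A homogeneous representative of the class of a monomial outside \<open>I\<close> still
  contains this monomial with coefficient \<open>1\<close>.\<close>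

lemma socle_exponent_degree:
  assumes "socle I \<subseteq> quot_part I d" "m \<in> socle_exponents"
  shows "int (mdeg m) = d"
proof -
  have "cls I (monom m) \<in> quot_part I d" using cls_monom_in_socle[OF assms(2)] assms(1) by blast
  then obtain h where h: "h \<in> hom_part d" "monom m - h \<in> I"
    unfolding quot_part_def by (auto simp: cls_eq_iff)
  have "m \<notin> E" using assms(2) unfolding socle_exponents_def by simp
  from lookup_eq_0[OF h(2) this] have "Poly_Mapping.lookup h m = 1"
    by (simp add: lookup_minus monom_def)
  then have "m \<in> Poly_Mapping.keys h" by (simp add: in_keys_iff)
  then show ?thesis using h(1) unfolding hom_part_def by blast
qed

text \<open>The constants are the image of a field in a nonzero ring: \<open>E \<noteq> UNIV\<close>
  forces \<open>0 \<notin> E\<close>, so \<open>1\<close> is not in \<open>I\<close>.\<close>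

lemma constants_subfield:
  assumes "E \<noteq> UNIV"
  shows "subfield (cls I ` range const) (quot I)"
proof -
  let ?F = "ring_of_type_algebra :: 'k ring"
  let ?h = "\<lambda>c. cls I (const c)"
  have "0 \<notin> E" using up[of 0] assms by auto
  then have "1 \<notin> I" unfolding I_eq by simp
  then have one: "\<one>\<^bsub>quot I\<^esub> \<noteq> \<zero>\<^bsub>quot I\<^esub>" unfolding cls_one cls_eq_zero_iff .
  have "?h \<in> Ring.ring_hom ?F (quot I)"
    by (rule ring_hom_memI)
       (auto simp: ring_of_type_algebra_def cls_mult cls_add cls_one const_def mult_single single_add)
  then have "ring_hom_ring ?F (quot I) ?h"
    using ring_hom_ringI2[OF ring_from_type_algebra Q.ring_axioms] by blast
  from ring_hom_ring.img_is_subfield(2)[OF this field.carrier_is_subfield[OF field_from_type_algebra] one]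
  show ?thesis by (simp add: ring_of_type_algebra_def image_image)
qed

text \<open>A combination with constant coefficients is the class of the polynomial with these
  coefficients; having distinct exponents outside \<open>E\<close>, it lies in \<open>I\<close> only
  if all coefficients vanish.\<close>

lemma independent_monomials:
  assumes "distinct ms" "set ms \<inter> E = {}" "E \<noteq> UNIV"
  shows "Q.independent (cls I ` range const) (map (\<lambda>m. cls I (monom m)) ms)"
proof (rule Q.trivial_combine_imp_independent[OF constants_subfield[OF assms(3)]])
  let ?P = "\<lambda>cs ms. sum_list (map2 (\<lambda>c m. Poly_Mapping.single m c) cs ms) :: ('v, 'k) mvpoly"
  have comb: "Q.combine (map (\<lambda>c. cls I (const c)) cs) (map (\<lambda>m. cls I (monom m)) ms) = cls I (?P cs ms)" for cs ms
  proof (induction cs arbitrary: ms)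
    case (Cons c cs)
    then show ?case
      by (cases ms) (simp_all add: cls_zero cls_mult cls_add const_def monom_def mult_single)
  qed (simp add: cls_zero)
  have keys: "Poly_Mapping.keys (?P cs ms) \<subseteq> set ms" for cs ms
  proof (induction cs arbitrary: ms)
    case (Cons c cs)
    show ?case
    proof (cases ms)
      case (Cons m ms')
      have "Poly_Mapping.keys (?P (c # cs) ms) \<subseteq> {m} \<union> Poly_Mapping.keys (?P cs ms')"
        using keys_add[of "Poly_Mapping.single m c" "?P cs ms'"] unfolding Cons by (auto split: if_splits)
      then show ?thesis using Cons.IH[of ms'] Cons by auto
    qed simp
  qed simp
  \<comment> \<open>Lists of unequal length are truncated by \<open>map2\<close> and by
    \<open>combine\<close>, hence the \<open>take\<close>.\<close>
  have zero: "set (take (length ms) cs) \<subseteq> {0}" if "?P cs ms \<in> I" "distinct ms" "set ms \<inter> E = {}" for cs ms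
    using that
  proof (induction ms arbitrary: cs)
    case (Cons m ms)
    show ?case
    proof (cases cs)
      case (Cons c cs')
      have "m \<notin> Poly_Mapping.keys (?P cs' ms)" using keys[of cs' ms] Cons.prems(2) by auto
      then have "Poly_Mapping.lookup (?P cs (m # ms)) m = c"
        unfolding Cons by (simp add: lookup_add in_keys_iff)
      then have "c = 0" using lookup_eq_0[OF Cons.prems(1)] Cons.prems(3) by auto
      then have "?P cs' ms \<in> I" using Cons.prems(1) unfolding Cons by simp
      then have "set (take (length ms) cs') \<subseteq> {0}" using Cons.IH Cons.prems by auto
      then show ?thesis using \<open>c = 0\<close> unfolding Cons by simp
    qed simp
  qed simp
  show "set (map (\<lambda>m. cls I (monom m)) ms) \<subseteq> carrier (quot I)" by auto
  fix Ks assume Ks: "set Ks \<subseteq> cls I ` range const"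
    and 0: "Q.combine Ks (map (\<lambda>m. cls I (monom m)) ms) = \<zero>\<^bsub>quot I\<^esub>"
  have "\<exists>cs. Ks = map (\<lambda>c. cls I (const c)) cs" using Ks
  proof (induction Ks)
    case (Cons k Ks)
    then obtain cs c where "Ks = map (\<lambda>c. cls I (const c)) cs" "k = cls I (const c)" by auto
    then show ?case by (intro exI[of _ "c # cs"]) simp
  qed simp
  then obtain cs where cs: "Ks = map (\<lambda>c. cls I (const c)) cs" by blast
  have "?P cs ms \<in> I" using 0 unfolding cs comb cls_eq_zero_iff .
  from zero[OF this assms(1,2)]
  show "set (take (length (map (\<lambda>m. cls I (monom m)) ms)) Ks) \<subseteq> {\<zero>\<^bsub>quot I\<^esub>}"
    unfolding cs by (auto simp: take_map cls_zero const_def)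
qed

lemma length_socle_exponents_le:
  assumes "Q.dimension n (cls I ` range const) (socle I)" "distinct ms" "set ms \<subseteq> socle_exponents"
  shows "length ms \<le> n"
proof (cases "E = UNIV")
  case True
  then have "ms = []" using assms(3) unfolding socle_exponents_def by (cases ms) auto
  then show ?thesis by simp
next
  case False
  have "set ms \<inter> E = {}" using assms(3) unfolding socle_exponents_def by auto
  note independent = independent_monomials[OF assms(2) this False]
  have "set (map (\<lambda>m. cls I (monom m)) ms) \<subseteq> socle I" using assms(3) cls_monom_in_socle by auto
  from Q.independent_length_le_dimension[OF constants_subfield[OF False] assms(1) independent this]
  show ?thesis by simp
qed

end

section \<open>The weak Lefschetz property\<close>

text \<open>Independent rows make the matrix surjective. By induction on the rows, a solution for
  the rows in \<open>U\<close> is corrected at a new row \<open>u0\<close> by a vector that the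
  other rows annihilate.\<close>

lemma surjective_if_left_kernel_trivial:
  fixes B :: "'u \<Rightarrow> 'w \<Rightarrow> 'k::field"
  assumes "finite U" "finite W"
    and "\<And>g. (\<And>w. w \<in> W \<Longrightarrow> (\<Sum>u\<in>U. g u * B u w) = 0) \<Longrightarrow> (\<And>u. u \<in> U \<Longrightarrow> g u = 0)"
  shows "\<exists>f. \<forall>u\<in>U. (\<Sum>w\<in>W. B u w * f w) = h u"
  using assms(1,3)
proof (induction U arbitrary: h rule: finite_induct)
  case empty
  then show ?case by simp
next
  case (insert u0 U)
  have "\<exists>f. \<forall>u\<in>U. (\<Sum>w\<in>W. B u w * f w) = h u" for h
  proof (rule insert.IH)
    fix g u assume *: "\<And>w. w \<in> W \<Longrightarrow> (\<Sum>u\<in>U. g u * B u w) = 0" "u \<in> U"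
    have "(\<Sum>u\<in>insert u0 U. (if u = u0 then 0 else g u) * B u w) = (\<Sum>u\<in>U. g u * B u w)" for w
      using insert.hyps by (auto intro!: sum.cong)
    then show "g u = 0"
      using insert.prems[of "\<lambda>u. if u = u0 then 0 else g u" u] * insert.hyps by (auto split: if_splits)
  qed
  then obtain F where F: "\<And>h u. u \<in> U \<Longrightarrow> (\<Sum>w\<in>W. B u w * F h w) = h u" by metis
  \<comment> \<open>\<open>d u\<close> solves the system for the unit vector at \<open>u\<close>.
    Evaluating row \<open>u0\<close> on it gives \<open>g u\<close>, the only possible coefficients
    for expressing row \<open>u0\<close> by the rows in \<open>U\<close>.\<close>
  define d where "d u = F (\<lambda>x. if x = u then 1 else 0)" for u
  have d: "(\<Sum>w\<in>W. B x w * d u w) = (if x = u then 1 else 0)" if "x \<in> U" for x u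
    using F[OF that] unfolding d_def .
  define g where "g u = (\<Sum>w\<in>W. B u0 w * d u w)" for u
  \<comment> \<open>Otherwise row \<open>u0\<close> would be a combination of the others, giving a
    left kernel vector with entry \<open>-1\<close> at \<open>u0\<close>.\<close>
  have "\<exists>w0\<in>W. B u0 w0 - (\<Sum>u\<in>U. g u * B u w0) \<noteq> 0"
  proof (rule ccontr)
    assume "\<not> ?thesis"
    then have *: "(\<Sum>u\<in>U. g u * B u w) = B u0 w" if "w \<in> W" for w using that by auto
    have "(\<Sum>u\<in>insert u0 U. (if u = u0 then -1 else g u) * B u w) = 0" if "w \<in> W" for w
    proof -
      have "(\<Sum>u\<in>U. (if u = u0 then -1 else g u) * B u w) = (\<Sum>u\<in>U. g u * B u w)"
        using insert.hyps by (intro sum.cong) auto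
      then show ?thesis using insert.hyps *[OF that] by simp
    qed
    from insert.prems[OF this, of u0] show False by simp
  qed
  then obtain w0 where w0: "w0 \<in> W" "B u0 w0 - (\<Sum>u\<in>U. g u * B u w0) \<noteq> 0" by blast
  \<comment> \<open>The unit vector at \<open>w0\<close>, corrected so that the rows in
    \<open>U\<close> annihilate it; row \<open>u0\<close> takes the nonzero value \<open>c\<close>
    on it.\<close>
  define k where "k w = (if w = w0 then 1 else 0) - (\<Sum>u\<in>U. B u w0 * d u w)" for w
  have k: "(\<Sum>w\<in>W. B x w * k w) = B x w0 - (\<Sum>u\<in>U. B u w0 * (\<Sum>w\<in>W. B x w * d u w))" for x
  proof -
    have "(\<Sum>w\<in>W. B x w * k w) = (\<Sum>w\<in>W. B x w * (if w = w0 then 1 else 0)) - (\<Sum>w\<in>W. \<Sum>u\<in>U. B u w0 * (B x w * d u w))"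
      unfolding k_def by (simp add: right_diff_distrib sum_subtractf sum_distrib_left mult.left_commute)
    also have "(\<Sum>w\<in>W. B x w * (if w = w0 then 1 else 0)) = B x w0"
      using w0(1) assms(2) by (simp add: if_distrib cong: if_cong)
    also have "(\<Sum>w\<in>W. \<Sum>u\<in>U. B u w0 * (B x w * d u w)) = (\<Sum>u\<in>U. B u w0 * (\<Sum>w\<in>W. B x w * d u w))"
      unfolding sum_distrib_left by (rule sum.swap)
    finally show ?thesis .
  qed
  have kU: "(\<Sum>w\<in>W. B x w * k w) = 0" if "x \<in> U" for x
    unfolding k using that insert.hyps(1) by (simp add: d[OF that] if_distrib cong: if_cong)
  define c where "c = B u0 w0 - (\<Sum>u\<in>U. g u * B u w0)"
  have kc: "(\<Sum>w\<in>W. B u0 w * k w) = c" unfolding k c_def g_def by (simp add: mult.commute)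
  have c: "c \<noteq> 0" using w0(2) unfolding c_def .
  define e where "e = (h u0 - (\<Sum>w\<in>W. B u0 w * F h w)) / c"
  have eq: "(\<Sum>w\<in>W. B u w * (F h w + e * k w)) = (\<Sum>w\<in>W. B u w * F h w) + e * (\<Sum>w\<in>W. B u w * k w)" for u
    by (simp add: distrib_left sum.distrib sum_distrib_left mult.left_commute)
  have "(\<Sum>w\<in>W. B u w * (F h w + e * k w)) = h u" if "u \<in> insert u0 U" for u
    unfolding eq using that F[of u h] kU[of u] kc c by (auto simp: e_def)
  then show ?case by (intro exI[of _ "\<lambda>w. F h w + e * k w"] ballI)
qed

lemma lookup_var_mult:
  fixes p :: "('v, 'k::comm_ring_1) mvpoly"
  shows "Poly_Mapping.lookup (var v * p) u =
    (if Poly_Mapping.lookup u v = 0 then 0 else Poly_Mapping.lookup p (u - Poly_Mapping.single v 1))"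
proof (cases "Poly_Mapping.lookup u v = 0")
  case True
  have "Poly_Mapping.single v 1 + w \<noteq> u" for w
  proof
    assume "Poly_Mapping.single v 1 + w = u"
    from arg_cong[OF this, of "\<lambda>m. Poly_Mapping.lookup m v"] show False using True by (simp add: lookup_add)
  qed
  then show ?thesis using True unfolding var_def monom_def by (simp add: lookup_single_mult_eq_0)
next
  case False
  have "Poly_Mapping.single v 1 + (u - Poly_Mapping.single v 1) = u"
    using False by (intro poly_mapping_eqI) (auto simp: lookup_add lookup_minus lookup_single when_def)
  then show ?thesis
    using False lookup_single_mult[of "Poly_Mapping.single v 1" 1 p "u - Poly_Mapping.single v 1"]
    unfolding var_def monom_def by simp
qed

section \<open>Exponents in three variables\<close>

lemma xyz_exhaust:
  assumes "distinct [v1, v2, v3 :: xyz]"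
  shows "v = v1 \<or> v = v2 \<or> v = v3"
  using assms by (cases v; cases v1; cases v2; cases v3) auto

lemma mdeg_xyz:
  assumes "distinct [v1, v2, v3 :: xyz]"
  shows "mdeg m = Poly_Mapping.lookup m v1 + Poly_Mapping.lookup m v2 + Poly_Mapping.lookup m v3"
proof -
  have "mdeg m = (\<Sum>v\<in>{v1, v2, v3}. Poly_Mapping.lookup m v)"
    unfolding mdeg_def using xyz_exhaust[OF assms]
    by (intro sum.mono_neutral_left) (auto simp: in_keys_iff)
  then show ?thesis using assms by simp
qed

lemma mdeg_xyz_add: "mdeg (m + n) = mdeg m + mdeg (n :: xyz \<Rightarrow>\<^sub>0 nat)"
  using mdeg_xyz[of Var_x Var_y Var_z] by (simp add: lookup_add)

lemma mdeg_xyz_single: "mdeg (Poly_Mapping.single v n :: xyz \<Rightarrow>\<^sub>0 nat) = n"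
  using mdeg_xyz[of Var_x Var_y Var_z] by (cases v) (simp_all add: lookup_single)

definition exponent_le :: "('v \<Rightarrow>\<^sub>0 nat) \<Rightarrow> ('v \<Rightarrow>\<^sub>0 nat) \<Rightarrow> bool" where
  "exponent_le m n \<longleftrightarrow> (\<forall>v. Poly_Mapping.lookup m v \<le> Poly_Mapping.lookup n v)"

lemma exponent_le_imp_add:
  assumes "exponent_le m n"
  shows "n = (n - m) + m"
  using assms unfolding exponent_le_def
  by (intro poly_mapping_eqI) (simp add: lookup_add lookup_minus)

text \<open>Pure powers in \<open>E\<close> bound the degrees outside \<open>E\<close>, so every
  exponent there lies below a maximal one. Socle dimension two leaves at most two maximal exponents,
  and a socle in one degree makes their degrees equal; \<open>m1 = m2\<close> is possible.\<close>

lemma level_type_two_exponents: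
  fixes I :: "(xyz, 'k::field) mvpoly set"
  assumes "monomial_quotient E I" "artinian_ring (quot I)" "level_of_type 2 I" "E \<noteq> UNIV"
  obtains m1 m2 where "mdeg m1 = mdeg m2" "\<And>m. m \<notin> E \<longleftrightarrow> exponent_le m m1 \<or> exponent_le m m2"
proof -
  interpret monomial_quotient E I by fact
  obtain N where N: "\<And>v. Poly_Mapping.single v (N v) \<in> E" using pure_power_exponent[OF assms(2)] by metis
  have bound: "mdeg m \<le> N Var_x + N Var_y + N Var_z" if "m \<notin> E" for m
  proof -
    have "Poly_Mapping.lookup m v \<le> N v" for v
    proof (rule ccontr)
      assume "\<not> Poly_Mapping.lookup m v \<le> N v"
      then have "exponent_le (Poly_Mapping.single v (N v)) m"
        unfolding exponent_le_def by (auto simp: lookup_single when_def)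
      from exponent_le_imp_add[OF this] show False
        using up[OF N[of v], of "m - Poly_Mapping.single v (N v)"] that by simp
    qed
    then show ?thesis using mdeg_xyz[of Var_x Var_y Var_z m] by (simp add: add_mono)
  qed
  have max: "\<exists>x\<in>socle_exponents. exponent_le m x" if "m \<notin> E" for m
    using that
  \<comment> \<open>Induction on the distance to the degree bound: an exponent that is not maximal
    can be raised in some variable.\<close>
  proof (induction "N Var_x + N Var_y + N Var_z - mdeg m" arbitrary: m rule: less_induct)
    case less
    show ?case
    proof (cases "m \<in> socle_exponents")
      case True
      then show ?thesis unfolding exponent_le_def by auto
    next
      case False
      then obtain v where v: "Poly_Mapping.single v 1 + m \<notin> E"
        using less.prems unfolding socle_exponents_def by blast
      have "mdeg (Poly_Mapping.single v 1 + m) = Suc (mdeg m)" by (simp add: mdeg_xyz_add mdeg_xyz_single)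
      then have "N Var_x + N Var_y + N Var_z - mdeg (Poly_Mapping.single v 1 + m) < N Var_x + N Var_y + N Var_z - mdeg m"
        using bound[OF v] by linarith
      from less.hyps[OF this v]
      obtain x where x: "x \<in> socle_exponents" "exponent_le (Poly_Mapping.single v 1 + m) x" by blast
      then have "exponent_le m x" unfolding exponent_le_def lookup_add by (meson add_leD2)
      then show ?thesis using x by blast
    qed
  qed
  obtain d where d: "socle I \<subseteq> quot_part I d" using assms(3) unfolding level_of_type_def by blast
  have "\<exists>m1\<in>socle_exponents. \<exists>m2\<in>socle_exponents. socle_exponents \<subseteq> {m1, m2}"
  proof (rule ccontr)
    assume *: "\<not> ?thesis"
    obtain m where "m \<notin> E" using assms(4) by blast
    then obtain x1 where x1: "x1 \<in> socle_exponents" using max by blast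
    then obtain x2 where x2: "x2 \<in> socle_exponents" "x2 \<noteq> x1" using * by blast
    then obtain x3 where x3: "x3 \<in> socle_exponents" "x3 \<noteq> x1" "x3 \<noteq> x2" using * x1 by blast
    have "length [x1, x2, x3] \<le> 2"
      using assms(3) x1 x2 x3 unfolding level_of_type_def by (intro length_socle_exponents_le) auto
    then show False by simp
  qed
  then obtain m1 m2 where m: "m1 \<in> socle_exponents" "m2 \<in> socle_exponents" "socle_exponents \<subseteq> {m1, m2}" by blast
  have "mdeg m1 = mdeg m2"
    using socle_exponent_degree[OF d m(1)] socle_exponent_degree[OF d m(2)] by simp
  moreover have "m \<notin> E \<longleftrightarrow> exponent_le m m1 \<or> exponent_le m m2" for m
  proof
    assume "m \<notin> E"
    then show "exponent_le m m1 \<or> exponent_le m m2" using max m(3) by blast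
  next
    assume *: "exponent_le m m1 \<or> exponent_le m m2"
    have "m1 \<notin> E" "m2 \<notin> E" using m unfolding socle_exponents_def by auto
    then show "m \<notin> E" using * exponent_le_imp_add up by metis
  qed
  ultimately show ?thesis by (rule that)
qed

text \<open>Two of the three comparisons go the same way, and equal sums force the third to go the
  opposite way.\<close>

lemma orient_variables:
  fixes f g :: "xyz \<Rightarrow> nat"
  assumes "f Var_x + f Var_y + f Var_z = g Var_x + g Var_y + g Var_z"
  obtains v1 v2 v3 where "distinct [v1, v2, v3]"
    "(g v1 \<le> f v1 \<and> g v2 \<le> f v2 \<and> f v3 \<le> g v3) \<or> (f v1 \<le> g v1 \<and> f v2 \<le> g v2 \<and> g v3 \<le> f v3)"
proof -
  consider "g Var_x \<le> f Var_x" "g Var_y \<le> f Var_y" | "g Var_x \<le> f Var_x" "g Var_z \<le> f Var_z"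
    | "g Var_y \<le> f Var_y" "g Var_z \<le> f Var_z" | "f Var_x \<le> g Var_x" "f Var_y \<le> g Var_y"
    | "f Var_x \<le> g Var_x" "f Var_z \<le> g Var_z" | "f Var_y \<le> g Var_y" "f Var_z \<le> g Var_z"
    by linarith
  then show ?thesis
    using assms that[of Var_x Var_y Var_z] that[of Var_x Var_z Var_y] that[of Var_y Var_z Var_x]
    by cases auto
qed

text \<open>With \<open>L\<close> the sum of the variables and exponents read as integer triples,
  the alternatives of \<open>maximal_rank\<close> become injectivity and surjectivity in each
  degree.\<close>

lemma weak_lefschetz_two_boxes:
  fixes I :: "(xyz, 'k::field_char_0) mvpoly set"
  assumes "monomial_quotient E I" and dist: "distinct [v1, v2, v3]"
    and E: "\<And>m. m \<notin> E \<longleftrightarrow> exponent_le m m1 \<or> exponent_le m m2" and "mdeg m1 = mdeg m2"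
    and le: "Poly_Mapping.lookup m2 v1 \<le> Poly_Mapping.lookup m1 v1" "Poly_Mapping.lookup m2 v2 \<le> Poly_Mapping.lookup m1 v2"
      "Poly_Mapping.lookup m1 v3 \<le> Poly_Mapping.lookup m2 v3"
  shows "weak_lefschetz I"
proof -
  interpret monomial_quotient E I by fact
  note exh = xyz_exhaust[OF dist]
  define mk where "mk i j l = Poly_Mapping.single v1 (nat i) + Poly_Mapping.single v2 (nat j) + Poly_Mapping.single v3 (nat l)" for i j l
  have lk [simp]: "Poly_Mapping.lookup (mk i j l) v1 = nat i" "Poly_Mapping.lookup (mk i j l) v2 = nat j"
    "Poly_Mapping.lookup (mk i j l) v3 = nat l" for i j l
    using dist unfolding mk_def by (auto simp: lookup_add lookup_single when_def)
  have eqI: "m = n" if "Poly_Mapping.lookup m v1 = Poly_Mapping.lookup n v1" "Poly_Mapping.lookup m v2 = Poly_Mapping.lookup n v2"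
    "Poly_Mapping.lookup m v3 = Poly_Mapping.lookup n v3" for m n :: "xyz \<Rightarrow>\<^sub>0 nat"
    using that exh by (intro poly_mapping_eqI) metis
  have mk_lookup: "mk (int (Poly_Mapping.lookup m v1)) (int (Poly_Mapping.lookup m v2)) (int (Poly_Mapping.lookup m v3)) = m" for m
    by (rule eqI) simp_all
  have mk_add: "mk (i + 1) j l = Poly_Mapping.single v1 1 + mk i j l" "mk i (j + 1) l = Poly_Mapping.single v2 1 + mk i j l"
     "mk i j (l + 1) = Poly_Mapping.single v3 1 + mk i j l" if "0 \<le> i" "0 \<le> j" "0 \<le> l" for i j l
    using that dist by (auto intro!: eqI simp: lookup_add lookup_single when_def nat_add_distrib)
  have mdeg_mk: "int (mdeg (mk i j l)) = i + j + l" if "0 \<le> i" "0 \<le> j" "0 \<le> l" for i j l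
    using that mdeg_xyz[OF dist] by simp
  let ?l = "var v1 + var v2 + var v3 :: (xyz, 'k) mvpoly"
  have mdeg_l: "mdeg m = 1" if "m \<in> Poly_Mapping.keys ?l" for m
  proof -
    have "\<exists>v. m = Poly_Mapping.single v 1"
      using that keys_add[of "var v1 + var v2" "var v3 :: (xyz, 'k) mvpoly"] keys_add[of "var v1" "var v2 :: (xyz, 'k) mvpoly"]
      unfolding var_def monom_def by auto
    then show ?thesis using mdeg_xyz_single by metis
  qed
  then have l_hom: "?l \<in> hom_part 1" unfolding hom_part_def by simp
  have mult_hom: "?l * p \<in> hom_part (j + 1)" if "p \<in> hom_part j" for p j
  proof -
    have "int (mdeg m) = j + 1" if m: "m \<in> Poly_Mapping.keys (?l * p)" for m
    proof -
      obtain a b where ab: "m = a + b" "a \<in> Poly_Mapping.keys ?l" "b \<in> Poly_Mapping.keys p"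
        using keys_mult[of ?l p] m by blast
      then show ?thesis using mdeg_l[OF ab(2)] \<open>p \<in> hom_part j\<close>
        unfolding hom_part_def by (auto simp: mdeg_xyz_add)
    qed
    then show ?thesis unfolding hom_part_def by blast
  qed
  \<comment> \<open>Explicitly zero at negative exponents, which \<open>mk\<close> alone would
    truncate to \<open>0\<close>.\<close>
  define coeff where "coeff p i j l = (if 0 \<le> i \<and> 0 \<le> j \<and> 0 \<le> l then Poly_Mapping.lookup p (mk i j l) else 0)"
    for p :: "(xyz, 'k) mvpoly" and i j l
  have coeff_mult: "Poly_Mapping.lookup (?l * p) (mk i j l) = coeff p (i - 1) j l + coeff p i (j - 1) l + coeff p i j (l - 1)"
    if "0 \<le> i" "0 \<le> j" "0 \<le> l" for p i j l
  proof -
    have "mk i j l - Poly_Mapping.single v1 1 = mk (i - 1) j l" "mk i j l - Poly_Mapping.single v2 1 = mk i (j - 1) l"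
      "mk i j l - Poly_Mapping.single v3 1 = mk i j (l - 1)"
      using dist that by (auto intro!: eqI simp: lookup_minus lookup_single when_def nat_diff_distrib)
    then show ?thesis using that unfolding coeff_def by (auto simp: distrib_right lookup_add lookup_var_mult)
  qed
  define a1 b1 c1 a2 b2 c2 where "a1 = int (Poly_Mapping.lookup m1 v1)" and "b1 = int (Poly_Mapping.lookup m1 v2)"
    and "c1 = Poly_Mapping.lookup m1 v3" and "a2 = int (Poly_Mapping.lookup m2 v1)"
    and "b2 = int (Poly_Mapping.lookup m2 v2)" and "c2 = Poly_Mapping.lookup m2 v3"
  note defs = a1_def b1_def c1_def a2_def b2_def c2_def
  have boxes: "two_boxes a1 b1 a2 b2 c1 c2"
  proof
    have "Poly_Mapping.lookup m1 v1 + Poly_Mapping.lookup m1 v2 + Poly_Mapping.lookup m1 v3 =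
        Poly_Mapping.lookup m2 v1 + Poly_Mapping.lookup m2 v2 + Poly_Mapping.lookup m2 v3"
      using assms(4) unfolding mdeg_xyz[OF dist] .
    then show "a1 + b1 + int c1 = a2 + b2 + int c2" unfolding defs by linarith
  qed (use le in \<open>simp_all add: defs\<close>)
  have "inj_on (\<lambda>a. cls I ?l \<otimes>\<^bsub>quot I\<^esub> a) (quot_part I D) \<or>
        (\<lambda>a. cls I ?l \<otimes>\<^bsub>quot I\<^esub> a) ` quot_part I D = quot_part I (D + 1)" for D
  proof -
    interpret two_boxes a1 b1 a2 b2 c1 c2 D by (rule boxes)
    have exponent_le_iff: "exponent_le m n \<longleftrightarrow> Poly_Mapping.lookup m v1 \<le> Poly_Mapping.lookup n v1 \<and>
        Poly_Mapping.lookup m v2 \<le> Poly_Mapping.lookup n v2 \<and> Poly_Mapping.lookup m v3 \<le> Poly_Mapping.lookup n v3"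
      (is "_ \<longleftrightarrow> ?R") for m n
    proof
      assume ?R
      then have "Poly_Mapping.lookup m v \<le> Poly_Mapping.lookup n v" for v using exh[of v] by auto
      then show "exponent_le m n" unfolding exponent_le_def by blast
    qed (simp add: exponent_le_def)
    have region_mk: "region i j l \<longleftrightarrow> 0 \<le> i \<and> 0 \<le> j \<and> 0 \<le> l \<and> mk i j l \<notin> E" for i j l
      unfolding region_def unfolding E exponent_le_iff defs by (auto simp: nat_le_iff)
    from maximal_rank[where 'k = 'k] show ?thesis
    proof (elim disjE)
      assume inj: "\<forall>f :: int \<Rightarrow> int \<Rightarrow> int \<Rightarrow> 'k. (\<forall>i j l. f i j l \<noteq> 0 \<longrightarrow> region i j l \<and> i + j + l = D) \<longrightarrow>
            (\<forall>i j l. region i j l \<longrightarrow> i + j + l = D + 1 \<longrightarrow> f (i - 1) j l + f i (j - 1) l + f i j (l - 1) = 0) \<longrightarrow>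
            (\<forall>i j l. f i j l = 0)"
      have ker: "p \<in> I" if p: "p \<in> hom_part D" "?l * p \<in> I" for p
      proof (rule memI)
        fix m assume m: "m \<notin> E"
        define f where "f i j l = (if region i j l \<and> i + j + l = D then coeff p i j l else 0)" for i j l
        have A: "\<forall>i j l. f i j l \<noteq> 0 \<longrightarrow> region i j l \<and> i + j + l = D" unfolding f_def by simp
        have B: "\<forall>i j l. region i j l \<longrightarrow> i + j + l = D + 1 \<longrightarrow> f (i - 1) j l + f i (j - 1) l + f i j (l - 1) = 0"
        proof (intro allI impI)
          fix i j l assume r: "region i j l" "i + j + l = D + 1"
          \<comment> \<open>The region is closed under division, so a predecessor of a point in it
            lies in it again or has a negative exponent; in both cases \<open>f\<close> equals
            \<open>coeff p\<close>.\<close>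
          then have "f (i - 1) j l = coeff p (i - 1) j l" "f i (j - 1) l = coeff p i (j - 1) l" "f i j (l - 1) = coeff p i j (l - 1)"
            unfolding f_def coeff_def region_def by auto
          then show "f (i - 1) j l + f i (j - 1) l + f i j (l - 1) = 0"
            using coeff_mult[of i j l p] lookup_eq_0[OF p(2), of "mk i j l"] r(1) unfolding region_mk by simp
        qed
        have zero: "f i j l = 0" for i j l
          using mp[OF mp[OF spec[OF inj, of f] A] B] by blast
        show "Poly_Mapping.lookup p m = 0"
        proof (cases "m \<in> Poly_Mapping.keys p")
          case True
          then have "int (mdeg m) = D" using p(1) unfolding hom_part_def by blast
          then show ?thesis
            using m zero[of "int (Poly_Mapping.lookup m v1)" "int (Poly_Mapping.lookup m v2)" "int (Poly_Mapping.lookup m v3)"]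
            unfolding f_def coeff_def region_mk mk_lookup mdeg_xyz[OF dist] by simp
        qed (simp add: in_keys_iff)
      qed
      have "inj_on (\<lambda>a. cls I ?l \<otimes>\<^bsub>quot I\<^esub> a) (quot_part I D)"
      proof (rule inj_onI)
        fix a b assume "a \<in> quot_part I D" "b \<in> quot_part I D"
        then obtain p q where p: "p \<in> hom_part D" "a = cls I p" and q: "q \<in> hom_part D" "b = cls I q"
          unfolding quot_part_def by blast
        assume "cls I ?l \<otimes>\<^bsub>quot I\<^esub> a = cls I ?l \<otimes>\<^bsub>quot I\<^esub> b"
        then have "?l * (p - q) \<in> I" unfolding p q cls_mult cls_eq_iff right_diff_distrib .
        moreover have "p - q \<in> hom_part D"
          using p(1) q(1) unfolding hom_part_def by (auto simp: in_keys_iff lookup_minus)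
        ultimately show "a = b" using ker unfolding p q cls_eq_iff by blast
      qed
      then show ?thesis ..
    next
      assume inj: "\<forall>g :: int \<Rightarrow> int \<Rightarrow> int \<Rightarrow> 'k. (\<forall>i j l. g i j l \<noteq> 0 \<longrightarrow> region i j l \<and> i + j + l = D + 1) \<longrightarrow>
            (\<forall>i j l. region i j l \<longrightarrow> i + j + l = D \<longrightarrow> g (i + 1) j l + g i (j + 1) l + g i j (l + 1) = 0) \<longrightarrow>
            (\<forall>i j l. g i j l = 0)"
      \<comment> \<open>\<open>W\<close> and \<open>U\<close> index the monomial bases of the
        quotient in degrees \<open>D\<close> and \<open>D + 1\<close>; \<open>B\<close> is the
        matrix of multiplication by \<open>L\<close>.\<close>
      define W where "W = {m. m \<notin> E \<and> int (mdeg m) = D}"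
      define U where "U = {m. m \<notin> E \<and> int (mdeg m) = D + 1}"
      define B where "B u w = Poly_Mapping.lookup (?l * monom w) u" for u w
      have fin: "finite {m :: xyz \<Rightarrow>\<^sub>0 nat. int (mdeg m) = d}" for d
      proof (rule finite_surj)
        show "finite ({0..d} \<times> {0..d} \<times> {0..d})" by simp
        show "{m. int (mdeg m) = d} \<subseteq> (\<lambda>(i, j, l). mk i j l) ` ({0..d} \<times> {0..d} \<times> {0..d})"
        proof
          fix m :: "xyz \<Rightarrow>\<^sub>0 nat" assume "m \<in> {m. int (mdeg m) = d}"
          then have "(int (Poly_Mapping.lookup m v1), int (Poly_Mapping.lookup m v2), int (Poly_Mapping.lookup m v3))
              \<in> {0..d} \<times> {0..d} \<times> {0..d}"
            using mdeg_xyz[OF dist, of m] by auto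
          moreover have "m = (\<lambda>(i, j, l). mk i j l)
              (int (Poly_Mapping.lookup m v1), int (Poly_Mapping.lookup m v2), int (Poly_Mapping.lookup m v3))"
            using mk_lookup[of m] by simp
          ultimately show "m \<in> (\<lambda>(i, j, l). mk i j l) ` ({0..d} \<times> {0..d} \<times> {0..d})" by (rule rev_image_eqI)
        qed
      qed
      have finW: "finite W" and finU: "finite U"
        using finite_subset[OF _ fin[of D], of W] finite_subset[OF _ fin[of "D + 1"], of U]
        unfolding W_def U_def by auto
      have B_eq: "B u w = (if u = Poly_Mapping.single v1 1 + w then 1 else 0) + (if u = Poly_Mapping.single v2 1 + w then 1 else 0)
          + (if u = Poly_Mapping.single v3 1 + w then 1 else 0)" for u w
      proof -
        have "var v * monom w = (monom (Poly_Mapping.single v 1 + w) :: (xyz, 'k) mvpoly)" for v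
          unfolding var_def monom_def mult_single by simp
        then show ?thesis
          unfolding B_def distrib_right lookup_add by (auto simp: monom_def lookup_single when_def)
      qed
      have left_kernel: "g u = 0" if g: "\<And>w. w \<in> W \<Longrightarrow> (\<Sum>u\<in>U. g u * B u w) = 0" and u: "u \<in> U" for g u
      proof -
        define G where "G i j l = (if region i j l \<and> i + j + l = D + 1 then g (mk i j l) else 0)" for i j l
        have A: "\<forall>i j l. G i j l \<noteq> 0 \<longrightarrow> region i j l \<and> i + j + l = D + 1" unfolding G_def by simp
        have C: "\<forall>i j l. region i j l \<longrightarrow> i + j + l = D \<longrightarrow> G (i + 1) j l + G i (j + 1) l + G i j (l + 1) = 0"
        proof (intro allI impI)
          fix i j l assume r: "region i j l" "i + j + l = D"
          then have nn: "0 \<le> i" "0 \<le> j" "0 \<le> l" and "mk i j l \<notin> E" unfolding region_mk by auto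
          let ?w = "mk i j l"
          have "?w \<in> W" using r nn \<open>?w \<notin> E\<close> mdeg_mk unfolding W_def by simp
          have U: "Poly_Mapping.single v 1 + ?w \<in> U \<longleftrightarrow> Poly_Mapping.single v 1 + ?w \<notin> E" for v
            using mdeg_mk[OF nn] r(2) unfolding U_def by (simp add: mdeg_xyz_add mdeg_xyz_single)
          have G: "G (i + 1) j l = (if Poly_Mapping.single v1 1 + ?w \<in> U then g (Poly_Mapping.single v1 1 + ?w) else 0)"
            "G i (j + 1) l = (if Poly_Mapping.single v2 1 + ?w \<in> U then g (Poly_Mapping.single v2 1 + ?w) else 0)"
            "G i j (l + 1) = (if Poly_Mapping.single v3 1 + ?w \<in> U then g (Poly_Mapping.single v3 1 + ?w) else 0)"
            using nn r(2) unfolding G_def region_mk mk_add[OF nn] U by auto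
          have S: "(\<Sum>u\<in>U. g u * (if u = x then 1 else 0)) = (if x \<in> U then g x else 0)" for x
            using finU by (simp add: if_distrib cong: if_cong)
          have "(\<Sum>u\<in>U. g u * B u ?w) = G (i + 1) j l + G i (j + 1) l + G i j (l + 1)"
            unfolding B_eq G distrib_left sum.distrib S ..
          then show "G (i + 1) j l + G i (j + 1) l + G i j (l + 1) = 0" using g[OF \<open>?w \<in> W\<close>] by simp
        qed
        have zero: "G i j l = 0" for i j l
          using mp[OF mp[OF spec[OF inj, of G] A] C] by blast
        then show ?thesis
          using u zero[of "int (Poly_Mapping.lookup u v1)" "int (Poly_Mapping.lookup u v2)" "int (Poly_Mapping.lookup u v3)"]
          unfolding G_def region_mk mk_lookup U_def mdeg_xyz[OF dist] by simp
      qed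
      have surj: "\<exists>p\<in>hom_part D. ?l * p - h \<in> I" if h: "h \<in> hom_part (D + 1)" for h
      proof -
        have "\<exists>f. \<forall>u\<in>U. (\<Sum>w\<in>W. B u w * f w) = Poly_Mapping.lookup h u"
          by (rule surjective_if_left_kernel_trivial[OF finU finW]) (rule left_kernel)
        then obtain f where f: "\<And>u. u \<in> U \<Longrightarrow> (\<Sum>w\<in>W. B u w * f w) = Poly_Mapping.lookup h u" by blast
        define p where "p = (\<Sum>w\<in>W. Poly_Mapping.single w (f w))"
        have "Poly_Mapping.lookup p m = (if m \<in> W then f m else 0)" for m
          using finW unfolding p_def by (simp add: lookup_sum lookup_single when_def)
        then have p: "p \<in> hom_part D" unfolding hom_part_def W_def by (auto simp: in_keys_iff split: if_splits)
        have "?l * p - h \<in> I"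
        proof (rule memI)
          fix m assume m: "m \<notin> E"
          show "Poly_Mapping.lookup (?l * p - h) m = 0"
          \<comment> \<open>Both polynomials are homogeneous of degree \<open>D + 1\<close>; in that
            degree the coefficients of \<open>p\<close> solve the linear system.\<close>
          proof (cases "int (mdeg m) = D + 1")
            case True
            have "Poly_Mapping.lookup (?l * Poly_Mapping.single w c) m = B m w * c" for w c
            proof -
              have "?l * Poly_Mapping.single w c = Poly_Mapping.single 0 c * (?l * monom w)"
                unfolding monom_def by (simp add: mult.left_commute[of _ ?l] mult_single)
              then show ?thesis
                using lookup_single_mult[of 0 c "?l * monom w" m] unfolding B_def by (simp add: mult.commute)
            qed
            then have "Poly_Mapping.lookup (?l * p) m = (\<Sum>w\<in>W. B m w * f w)"
              unfolding p_def sum_distrib_left lookup_sum by simp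
            also have "\<dots> = Poly_Mapping.lookup h m" using True m by (intro f) (simp add: U_def)
            finally show ?thesis by (simp add: lookup_minus)
          next
            case False
            then have "m \<notin> Poly_Mapping.keys (?l * p)" "m \<notin> Poly_Mapping.keys h"
              using mult_hom[OF p] h unfolding hom_part_def by auto
            then show ?thesis by (simp add: lookup_minus in_keys_iff)
          qed
        qed
        then show ?thesis using p by blast
      qed
      have "(\<lambda>a. cls I ?l \<otimes>\<^bsub>quot I\<^esub> a) ` quot_part I D = quot_part I (D + 1)"
      proof (intro equalityI subsetI)
        fix b assume "b \<in> (\<lambda>a. cls I ?l \<otimes>\<^bsub>quot I\<^esub> a) ` quot_part I D"
        then obtain p where p: "p \<in> hom_part D" "b = cls I (?l * p)" unfolding quot_part_def by (auto simp: cls_mult)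
        then show "b \<in> quot_part I (D + 1)" using mult_hom[OF p(1)] unfolding quot_part_def by blast
      next
        fix b assume "b \<in> quot_part I (D + 1)"
        then obtain h where h: "h \<in> hom_part (D + 1)" "b = cls I h" unfolding quot_part_def by blast
        then obtain p where p: "p \<in> hom_part D" "?l * p - h \<in> I" using surj by blast
        then have "b = cls I ?l \<otimes>\<^bsub>quot I\<^esub> cls I p" unfolding h cls_mult using cls_eq_iff by metis
        then show "b \<in> (\<lambda>a. cls I ?l \<otimes>\<^bsub>quot I\<^esub> a) ` quot_part I D" using p(1) unfolding quot_part_def by blast
      qed
      then show ?thesis ..
    qed
  qed
  moreover have "cls I ?l \<in> quot_part I 1" unfolding quot_part_def using l_hom by blast
  ultimately show ?thesis unfolding weak_lefschetz_def by blast
qed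

theorem theorem6p2:
  fixes I :: "(xyz, 'k::field_char_0) mvpoly set"
  assumes "monomial_ideal I"
    and "artinian_ring (quot I)"
    and "level_of_type 2 I"
  shows "weak_lefschetz I"
proof -
  obtain E where E: "\<And>m n. m \<in> E \<Longrightarrow> n + m \<in> E" "I = {p. Poly_Mapping.keys p \<subseteq> E}"
    using monomial_ideal_exponents[OF assms(1)] by blast
  then have mq: "monomial_quotient E I" by unfold_locales
  show ?thesis
  proof (cases "E = UNIV")
    \<comment> \<open>The quotient is the zero ring, on which every map is injective.\<close>
    case True
    then have "cls I p = cls I q" for p q
      using E(2) monomial_quotient.cls_eq_iff[OF mq, of p q] by simp
    then have "inj_on (\<lambda>a. L \<otimes>\<^bsub>quot I\<^esub> a) (quot_part I j)" for L j
      unfolding quot_part_def by (auto intro!: inj_onI)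
    moreover have "cls I 0 \<in> quot_part I 1" unfolding quot_part_def hom_part_def by simp
    ultimately show ?thesis unfolding weak_lefschetz_def by blast
  next
    case False
    then obtain m1 m2 where deg: "mdeg m1 = mdeg m2"
      and m: "\<And>m. m \<notin> E \<longleftrightarrow> exponent_le m m1 \<or> exponent_le m m2"
      using level_type_two_exponents[OF mq assms(2,3)] by blast
    have m': "m \<notin> E \<longleftrightarrow> exponent_le m m2 \<or> exponent_le m m1" for m using m by blast
    have "Poly_Mapping.lookup m1 Var_x + Poly_Mapping.lookup m1 Var_y + Poly_Mapping.lookup m1 Var_z =
        Poly_Mapping.lookup m2 Var_x + Poly_Mapping.lookup m2 Var_y + Poly_Mapping.lookup m2 Var_z"
      using deg mdeg_xyz[of Var_x Var_y Var_z] by simp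
    then show ?thesis
    proof (rule orient_variables)
      fix v1 v2 v3 assume "distinct [v1, v2, v3]"
        "(Poly_Mapping.lookup m2 v1 \<le> Poly_Mapping.lookup m1 v1 \<and> Poly_Mapping.lookup m2 v2 \<le> Poly_Mapping.lookup m1 v2 \<and>
          Poly_Mapping.lookup m1 v3 \<le> Poly_Mapping.lookup m2 v3) \<or>
         (Poly_Mapping.lookup m1 v1 \<le> Poly_Mapping.lookup m2 v1 \<and> Poly_Mapping.lookup m1 v2 \<le> Poly_Mapping.lookup m2 v2 \<and>
          Poly_Mapping.lookup m2 v3 \<le> Poly_Mapping.lookup m1 v3)"
      \<comment> \<open>The second orientation is the first one with the two socle monomials
        exchanged.\<close>
      then show ?thesis
        using weak_lefschetz_two_boxes[OF mq _ m deg] weak_lefschetz_two_boxes[OF mq _ m' deg[symmetric]] by blast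
    qed
  qed
qed

end
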